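(* Consider $$-\left(\varphi_p(u')\right)'+q(x)\varphi_p(u)=\lambda m(x)f(u),\quad 0<x<T,\qquad u(0)=u(T),\ u'(0)=u'(T),\qquad (N)$$ where $f\in C(\mathbb{R},\mathbb{R})$ satisfies $f(s)s>0$ for $s\neq0$. If $f_0\in(0,+\infty)$ and $f_\infty\in(0,+\infty)$, then for $\nu\in\{+,-\}$ and any $$\lambda\in\left(\lambda_0^\nu/f_\infty,\lambda_0^\nu/f_0\right)\cup\left(\lambda_0^\nu/f_0,\lambda_0^\nu/f_\infty\right),$$ problem (N) has two solutions $u^+$ and $u^-$ such that $u^+$ is positive and $u^-$ is negative on $[0,T]$.
   Context: Here $T>0$, $1<p<+\infty$, $\varphi_p(s)=|s|^{p-2}s$ (with $\varphi_p(0)=0$), $q\in C([0,T];[0,+\infty))$ with $q\not\equiv0$, and $m:[0,T]\to\mathbb{R}$ is a continuous sign-changing weight (it takes both positive and negative values). $f_0=\lim_{|s|\to0}f(s)/\varphi_p(s)$ and $f_\infty=\lim_{|s|\to+\infty}f(s)/\varphi_p(s)$ (assumed to exist). With $W_T^{1,p}(0,T)=\{u\in W^{1,p}(0,T)\mid u(0)=u(T)\}$, $\lambda_0^+=\inf\{\int_0^T(|u'|^p+q|u|^p)\,dx\mid u\in W_T^{1,p}(0,T),\ \int_0^T m|u|^p\,dx=1\}>0$ and $\lambda_0^-=\max\{-\int_0^T(|u'|^p+q|u|^p)\,dx\mid u\in W_T^{1,p}(0,T),\ \int_0^T -m|u|^p\,dx=1\}<0$. An interval $(a,b)$ with $a\ge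 b$ is empty. Solutions are classical. *)

theory Defs
  imports "HOL-Analysis.Analysis"
begin

definition phi :: "real \<Rightarrow> real \<Rightarrow> real" where
  "phi p s = \<bar>s\<bar> powr (p - 2) * s"

definition in_Lp :: "real \<Rightarrow> real set \<Rightarrow> (real \<Rightarrow> real) \<Rightarrow> bool" where
  "in_Lp p A u \<longleftrightarrow>
     set_borel_measurable lborel A u \<and> set_integrable lborel A (\<lambda>x. \<bar>u x\<bar> powr p)"

text \<open>\<^term>\<open>test_function A \<psi> \<psi>'\<close>: the function \<open>\<psi>\<close> is of class \<open>C\<^sup>1\<close> with compact support in the
  open set \<open>A\<close>, and \<open>\<psi>'\<close> is its derivative.\<close>
definition test_function :: "real set \<Rightarrow> (real \<Rightarrow> real) \<Rightarrow> (real \<Rightarrow> real) \<Rightarrow> bool" where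
  "test_function A \<psi> \<psi>' \<longleftrightarrow>
     (\<forall>x. (\<psi> has_real_derivative \<psi>' x) (at x)) \<and> continuous_on UNIV \<psi>' \<and>
     (\<exists>K. compact K \<and> K \<subseteq> A \<and> (\<forall>x. x \<notin> K \<longrightarrow> \<psi> x = 0))"

text \<open>\<open>u \<in> W\<^sup>1\<^sup>,\<^sup>p(A)\<close> with weak derivative \<open>u'\<close>, which is determined up to null sets.\<close>
definition in_W1p :: "real \<Rightarrow> real set \<Rightarrow> (real \<Rightarrow> real) \<Rightarrow> (real \<Rightarrow> real) \<Rightarrow> bool" where
  "in_W1p p A u u' \<longleftrightarrow>
     in_Lp p A u \<and> in_Lp p A u' \<and>
     (\<forall>\<psi> \<psi>'. test_function A \<psi> \<psi>' \<longrightarrow>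
        (LINT x:A|lborel. u x * \<psi>' x) = - (LINT x:A|lborel. u' x * \<psi> x))"

text \<open>The boundary values of a Sobolev function on \<open>(0,T)\<close> are those of its unique representative
  that is continuous on \<open>[0,T]\<close>; here \<open>u\<close> is that representative.\<close>
definition in_W1p_per :: "real \<Rightarrow> real \<Rightarrow> (real \<Rightarrow> real) \<Rightarrow> (real \<Rightarrow> real) \<Rightarrow> bool" where
  "in_W1p_per p T u u' \<longleftrightarrow>
     in_W1p p {0<..<T} u u' \<and> continuous_on {0..T} u \<and> u 0 = u T"

definition energy ::
  "real \<Rightarrow> real \<Rightarrow> (real \<Rightarrow> real) \<Rightarrow> (real \<Rightarrow> real) \<Rightarrow> (real \<Rightarrow> real) \<Rightarrow> real" where
  "energy p T q u u' =
     (LINT x:{0<..<T}|lborel. \<bar>u' x\<bar> powr p + q x * \<bar>u x\<bar> powr p)"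

definition lambda0_plus ::
  "real \<Rightarrow> real \<Rightarrow> (real \<Rightarrow> real) \<Rightarrow> (real \<Rightarrow> real) \<Rightarrow> real" where
  "lambda0_plus p T q m =
     Inf {energy p T q u u' | u u'. in_W1p_per p T u u' \<and>
            (LINT x:{0<..<T}|lborel. m x * \<bar>u x\<bar> powr p) = 1}"

definition lambda0_minus ::
  "real \<Rightarrow> real \<Rightarrow> (real \<Rightarrow> real) \<Rightarrow> (real \<Rightarrow> real) \<Rightarrow> real" where
  "lambda0_minus p T q m =
     (GREATEST l. l \<in> {- energy p T q u u' | u u'. in_W1p_per p T u u' \<and>
            (LINT x:{0<..<T}|lborel. - m x * \<bar>u x\<bar> powr p) = 1})"

text \<open>Classical solutions of the periodic problem: \<open>u\<close> is \<open>C\<^sup>1\<close> on \<open>[0,T]\<close> (one-sided at the end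
  points), with derivative \<open>v\<close>, and \<open>\<phi>\<^sub>p(u')\<close> is differentiable on \<open>(0,T)\<close>. For continuous data, the
  equation itself makes the derivative of \<open>\<phi>\<^sub>p(u')\<close> continuous up to the boundary.\<close>
definition classical_solution ::
  "real \<Rightarrow> real \<Rightarrow> (real \<Rightarrow> real) \<Rightarrow> (real \<Rightarrow> real) \<Rightarrow> (real \<Rightarrow> real) \<Rightarrow> real \<Rightarrow> (real \<Rightarrow> real) \<Rightarrow> bool"
where
  "classical_solution p T q m f lam u \<longleftrightarrow>
     (\<exists>v. (\<forall>x\<in>{0..T}. (u has_real_derivative v x) (at x within {0..T})) \<and>
          continuous_on {0..T} v \<and>
          (\<forall>x\<in>{0<..<T}. \<exists>w. ((\<lambda>t. phi p (v t)) has_real_derivative w) (at x) \<and>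
               - w + q x * phi p (u x) = lam * m x * f (u x)) \<and>
          u 0 = u T \<and> v 0 = v T)"

end

theory Submission
  imports Defs "HOL-Complex_Analysis.Great_Picard"
begin

text \<open>A positive solution \<open>u\<close> is sought in the form \<open>exp y\<close>. With \<open>w = \<phi>\<^sub>p(u') / \<phi>\<^sub>p(u)\<close> and
  \<open>r = p / (p - 1)\<close>, the equation becomes the first order system
  \<open>y' = \<phi>\<^sub>r(w)\<close>, \<open>w' = a(x, y) - (p - 1)|w|\<^sup>r\<close>, where \<open>a(x, y) = q - \<lambda> m f(u) / \<phi>\<^sub>p(u)\<close> is bounded
  and tends to \<open>q - \<lambda> f\<^sub>0 m\<close> and \<open>q - \<lambda> f\<^sub>\<infinity> m\<close> as \<open>y \<rightarrow> -\<infinity>\<close> and \<open>y \<rightarrow> \<infinity>\<close>. Replacing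
  \<open>a\<close> by \<open>a - \<mu>\<close> makes room for prescribing \<open>y(0)\<close>. As the principal eigenvalues of the two limit problems
  have opposite signs when \<open>\<lambda>\<close> lies between \<open>\<lambda>\<^sub>0 / f\<^sub>\<infinity>\<close> and \<open>\<lambda>\<^sub>0 / f\<^sub>0\<close>, a Brouwer argument in the three
  unknowns \<open>y(0)\<close>, \<open>\<mu>\<close>, \<open>w(0)\<close> gives a periodic solution with \<open>\<mu> = 0\<close>. Picone's inequality
  shows that \<open>\<lambda>\<^sub>0\<close> is the number \<open>s\<close> at which the principal eigenvalue for \<open>q - s m\<close> vanishes. The
  negative solution and \<open>\<lambda>\<^sub>0\<^sup>-\<close> follow from the symmetries \<open>u \<mapsto> -u\<close> and \<open>(\<lambda>, m) \<mapsto> (-\<lambda>, -m)\<close>.\<close>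

section \<open>The odd power function\<close>

text \<open>For r < 2 the function \<open>phi r\<close> is not Lipschitz at 0, and f is merely
  continuous, so initial values need not determine solutions and there is no shooting map; this is
  why fixed points are sought for Euler polygons. The logarithm makes positivity automatic and
  confines y to the bounded coefficient a. For a periodic solution w vanishes somewhere, which
  bounds |w|, and with it the oscillation of y, in terms of sup |a| alone. So if y(0) is large in
  modulus, all of y lies where a is near one of its limits, and \<mu>, which depends continuously on
  the coefficient, is near the eigenvalue of that limit problem. Pushing y(0) in the direction of
  \<sigma> \<mu>, with \<sigma> the sign of the eigenvalue belonging to small u, could then get
  stuck at an end of the range only with a sign of \<mu> that is impossible there. As
  \<open>lambda0_plus\<close> ranges over weakly differentiable functions, Picone's inequality has
  to hold for these, although its extremals exp y are continuously differentiable.\<close>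

lemma phi_zero [simp]: "phi p 0 = 0"
  by (simp add: phi_def)

lemma phi_minus [simp]: "phi p (- s) = - phi p s"
  by (simp add: phi_def)

lemma phi_pos: "s > 0 \<Longrightarrow> phi p s = s powr (p - 1)"
  using powr_add[of s "p - 2" 1] by (simp add: phi_def)

lemma phi_sgn: "phi p s = sgn s * \<bar>s\<bar> powr (p - 1)"
proof -
  consider "s = 0" | "s > 0" | "- s > 0" by linarith
  then show ?thesis
  proof cases
    case 3
    then show ?thesis using phi_pos[OF 3, of p] by (simp add: sgn_if)
  qed (simp_all add: phi_pos)
qed

lemma phi_mult_self: "phi p s * s = \<bar>s\<bar> powr p"
proof (cases "s = 0")
  case False
  have "phi p s * s = \<bar>s\<bar> powr (p - 1) * \<bar>s\<bar> powr 1"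
    using False by (simp add: phi_sgn sgn_if)
  also have "\<dots> = \<bar>s\<bar> powr p" by (simp only: powr_add[symmetric]) simp
  finally show ?thesis .
qed simp

lemma abs_phi: "\<bar>phi p s\<bar> = \<bar>s\<bar> powr (p - 1)"
  by (simp add: phi_sgn abs_mult abs_sgn_eq)

lemma phi_mult: "phi p (s * t) = phi p s * phi p t"
  by (simp add: phi_sgn sgn_mult abs_mult powr_mult)

lemma phi_conjugate:
  assumes "p > 1"
  shows "phi p (phi (p / (p - 1)) s) = s"
proof (cases "s = 0")
  case False
  have e: "(p / (p - 1) - 1) * (p - 1) = 1"
    using assms by (simp add: field_simps)
  have "sgn (phi (p / (p - 1)) s) = sgn s"
    using False by (simp add: phi_sgn[of _ s] sgn_mult)
  then have "phi p (phi (p / (p - 1)) s) = sgn s * \<bar>s\<bar> powr ((p / (p - 1) - 1) * (p - 1))"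
    by (simp add: phi_sgn[of p "phi _ s"] abs_phi powr_powr)
  then show ?thesis
    using False unfolding e by (simp add: sgn_mult_abs)
qed simp

lemma continuous_on_phi [continuous_intros]:
  assumes "p > 1" "continuous_on S g"
  shows "continuous_on S (\<lambda>x. phi p (g x))"
proof -
  \<comment> \<open>The factor \<open>\<bar>s\<bar> powr (p - 2)\<close> of the definition is
    discontinuous at 0 for p \<le> 2; here the exponents are positive.\<close>
  have "phi p s = max 0 s powr (p - 1) - max 0 (- s) powr (p - 1)" for s
    by (simp add: phi_sgn max_def sgn_if)
  then show ?thesis
    using assms by (simp only:) (intro continuous_intros continuous_on_powr'; simp)
qed

lemma continuous_on_abs_powr [continuous_intros]:
  fixes g :: "'a::topological_space \<Rightarrow> real"
  assumes "p > 0" "continuous_on S g"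
  shows "continuous_on S (\<lambda>x. \<bar>g x\<bar> powr p)"
  using assms by (intro continuous_on_powr' continuous_intros) auto

lemma phi_strict_mono:
  assumes "p > 1" "s < t"
  shows "phi p s < phi p t"
proof -
  consider "0 < s" | "s = 0" | "s < 0" "t \<ge> 0" | "t < 0" by linarith
  then show ?thesis
  proof cases
    case 1
    then show ?thesis using assms by (simp add: phi_pos powr_less_mono2)
  next
    case 4
    have "\<bar>t\<bar> powr (p - 1) < \<bar>s\<bar> powr (p - 1)"
      using 4 assms by (intro powr_less_mono2) auto
    then show ?thesis using 4 assms by (simp add: phi_sgn)
  next
    case 3
    have "\<bar>s\<bar> powr (p - 1) > 0" "\<bar>t\<bar> powr (p - 1) \<ge> 0" using 3 by simp_all
    then have "phi p s < 0" "phi p t \<ge> 0" using 3 by (simp_all add: phi_sgn sgn_if)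
    then show ?thesis by linarith
  qed (use assms in \<open>simp_all add: phi_pos\<close>)
qed

lemma has_real_derivative_abs_powr:
  assumes "p > 1"
  shows "((\<lambda>s. \<bar>s\<bar> powr p) has_real_derivative p * phi p s) (at s)"
proof -
  consider "s > 0" | "s < 0" | "s = 0" by linarith
  then show ?thesis
  proof cases
    case 1
    have "((\<lambda>s. s powr p) has_real_derivative p * s powr (p - 1)) (at s)"
      using 1 by (auto intro!: derivative_eq_intros)
    then have "((\<lambda>s. \<bar>s\<bar> powr p) has_real_derivative p * s powr (p - 1)) (at s)"
      using 1 by (elim DERIV_cong_ev[THEN iffD1, rotated -1])
        (auto intro!: eventually_mono[OF eventually_nhds_in_open[of "{0<..}"]])
    then show ?thesis using 1 by (simp add: phi_pos)
  next
    case 2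
    have "((\<lambda>s. (- s) powr p) has_real_derivative - p * (- s) powr (p - 1)) (at s)"
      using 2 by (auto intro!: derivative_eq_intros)
    then have "((\<lambda>s. \<bar>s\<bar> powr p) has_real_derivative - p * (- s) powr (p - 1)) (at s)"
      using 2 by (elim DERIV_cong_ev[THEN iffD1, rotated -1])
        (auto intro!: eventually_mono[OF eventually_nhds_in_open[of "{..<0}"]])
    then show ?thesis using 2 by (simp add: phi_sgn)
  next
    case 3
    have "(\<lambda>h. \<bar>h\<bar> powr p / h) \<midarrow>0\<rightarrow> phi p 0"
    proof (rule Lim_transform_eventually)
      show "phi p \<midarrow>0\<rightarrow> phi p 0"
        using continuous_on_phi[OF assms continuous_on_id, of UNIV]
        by (metis UNIV_I continuous_on_eq_continuous_at open_UNIV isCont_def)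
      show "\<forall>\<^sub>F h in at 0. phi p h = \<bar>h\<bar> powr p / h"
        unfolding eventually_at_filter by (simp add: phi_mult_self[symmetric])
    qed
    then show ?thesis using 3 by (simp add: DERIV_def)
  qed
qed

text \<open>The pointwise core of Picone's inequality, with s = u, t = u' and w the Riccati
  function: Young's inequality with exponents \<open>p\<close> and \<open>p / (p - 1)\<close> for
  |t| and |phi p s| |w|. The conjugate power of |phi p s| is |s|^p.\<close>

lemma young_phi:
  assumes "p > 1"
  shows "p * phi p s * t * w \<le> \<bar>t\<bar> powr p + (p - 1) * \<bar>w\<bar> powr (p / (p - 1)) * \<bar>s\<bar> powr p"
proof -
  let ?r = "p / (p - 1)"
  have "\<bar>t\<bar> * (\<bar>phi p s\<bar> * \<bar>w\<bar>) \<le> \<bar>t\<bar> powr p / p + (\<bar>phi p s\<bar> * \<bar>w\<bar>) powr ?r / ?r"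
    using assms by (intro Youngs_inequality) (auto simp: field_simps)
  also have "(\<bar>phi p s\<bar> * \<bar>w\<bar>) powr ?r = \<bar>w\<bar> powr ?r * \<bar>s\<bar> powr p"
    using assms by (simp add: abs_phi powr_mult powr_powr)
  finally have "p * (\<bar>t\<bar> * (\<bar>phi p s\<bar> * \<bar>w\<bar>))
      \<le> p * (\<bar>t\<bar> powr p / p + \<bar>w\<bar> powr ?r * \<bar>s\<bar> powr p / ?r)"
    using assms by (intro mult_left_mono) auto
  also have "\<dots> = \<bar>t\<bar> powr p + (p - 1) * \<bar>w\<bar> powr ?r * \<bar>s\<bar> powr p"
    using assms by (simp add: field_simps)
  finally have "p * (\<bar>t\<bar> * (\<bar>phi p s\<bar> * \<bar>w\<bar>))
      \<le> \<bar>t\<bar> powr p + (p - 1) * \<bar>w\<bar> powr ?r * \<bar>s\<bar> powr p" .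
  moreover have "p * phi p s * t * w \<le> \<bar>p * phi p s * t * w\<bar>" by (rule abs_ge_self)
  moreover have "\<bar>p * phi p s * t * w\<bar> = p * (\<bar>t\<bar> * (\<bar>phi p s\<bar> * \<bar>w\<bar>))"
    using assms by (simp add: abs_mult)
  ultimately show ?thesis by linarith
qed

lemma abs_powr_above_tangent:
  assumes "p > 1"
  shows "\<bar>t\<bar> powr p \<ge> \<bar>s\<bar> powr p + p * phi p s * (t - s)"
  using young_phi[OF assms, of s t 1] phi_mult_self[of p s] by (simp add: algebra_simps)

section \<open>Functions on a compact interval\<close>

lemma continuous_Icc_bounded:
  fixes g :: "real \<Rightarrow> real"
  assumes "continuous_on {a..b} g"
  obtains B where "B > 0" "\<And>x. x \<in> {a..b} \<Longrightarrow> \<bar>g x\<bar> \<le> B"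
proof -
  have "bounded (g ` {a..b})"
    by (intro compact_imp_bounded compact_continuous_image assms compact_Icc)
  then obtain B where "B > 0" "\<forall>v\<in>g ` {a..b}. norm v \<le> B" unfolding bounded_pos by blast
  then show ?thesis by (intro that[of B]) auto
qed

text \<open>At the first zero after \<xi> the function arrives from below, so its derivative there
  cannot be negative.\<close>

lemma stays_negative:
  fixes d d' :: "real \<Rightarrow> real"
  assumes deriv: "\<And>x. x \<in> {a..b} \<Longrightarrow> (d has_real_derivative d' x) (at x within {a..b})"
    and zero: "\<And>x. x \<in> {a..b} \<Longrightarrow> d x = 0 \<Longrightarrow> d' x < 0"
    and "a \<le> \<xi>" "\<xi> \<le> \<eta>" "\<eta> \<le> b" "d \<xi> < 0"
  shows "d \<eta> < 0"
proof (rule ccontr)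
  assume "\<not> d \<eta> < 0"
  have cont: "continuous_on {\<xi>..\<eta>} d"
    using assms(3-5) by (auto intro!: continuous_on_subset[OF DERIV_continuous_on[OF deriv]])
  define Z where "Z = {x \<in> {\<xi>..\<eta>}. d x = 0}"
  have "closed Z" unfolding Z_def
    by (rule continuous_closed_preimage_constant[OF cont closed_atLeastAtMost])
  moreover have "bounded Z"
    by (rule bounded_subset[OF bounded_closed_interval[of \<xi> \<eta>]]) (auto simp: Z_def)
  ultimately have "compact Z" by (simp add: compact_eq_bounded_closed)
  moreover have "Z \<noteq> {}"
    using IVT'[of d \<xi> 0 \<eta>] cont assms \<open>\<not> d \<eta> < 0\<close> by (auto simp: Z_def)
  ultimately obtain z where z: "z \<in> Z" "\<And>x. x \<in> Z \<Longrightarrow> z \<le> x"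
    using compact_attains_inf[of Z] by auto
  then have "d z = 0" "z \<in> {a..b}" "\<xi> < z" "z \<le> \<eta>"
    using assms(3-6) by (auto simp: Z_def order.strict_iff_order)
  have neg: "d x < 0" if "\<xi> \<le> x" "x < z" for x
  proof (rule ccontr)
    assume "\<not> d x < 0"
    have "continuous_on {\<xi>..x} d"
      using that \<open>z \<le> \<eta>\<close> by (intro continuous_on_subset[OF cont]) auto
    then have "\<exists>x'. \<xi> \<le> x' \<and> x' \<le> x \<and> d x' = 0"
      using \<open>\<not> d x < 0\<close> \<open>d \<xi> < 0\<close> that by (intro IVT') auto
    then obtain x' where "\<xi> \<le> x'" "x' \<le> x" "d x' = 0" by blast
    then show False using z(2)[of x'] that \<open>z \<le> \<eta>\<close> by (auto simp: Z_def)
  qed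
  obtain e where e: "e > 0" "\<And>h. 0 < h \<Longrightarrow> z - h \<in> {a..b} \<Longrightarrow> h < e \<Longrightarrow> d z < d (z - h)"
    using has_real_derivative_neg_dec_left[OF deriv[OF \<open>z \<in> {a..b}\<close>] zero[OF \<open>z \<in> {a..b}\<close> \<open>d z = 0\<close>]]
    by blast
  define h where "h = min (e / 2) (z - \<xi>)"
  have "0 < h" "h < e" "\<xi> \<le> z - h" "z - h < z"
    using e \<open>\<xi> < z\<close> by (auto simp: h_def min_def)
  then show False
    using e(2)[of h] neg[of "z - h"] \<open>z \<in> {a..b}\<close> assms(3) \<open>d z = 0\<close> by auto
qed

text \<open>The comparison principle for periodic Riccati equations. A zero is only crossed
  downwards, after which the function stays negative up to \<open>b\<close>; by periodicity it
  starts negative at \<open>a\<close> and so never reaches the zero.\<close>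

lemma periodic_no_crossing:
  fixes d d' :: "real \<Rightarrow> real"
  assumes deriv: "\<And>x. x \<in> {a..b} \<Longrightarrow> (d has_real_derivative d' x) (at x within {a..b})"
    and zero: "\<And>x. x \<in> {a..b} \<Longrightarrow> d x = 0 \<Longrightarrow> d' x < 0"
    and "d a = d b" "a < b" "x \<in> {a..b}"
  shows "d x \<noteq> 0"
proof
  assume "d x = 0"
  \<comment> \<open>A zero at \<open>b\<close> is also one at \<open>a\<close>, where there is room
    on the right.\<close>
  define \<xi> where "\<xi> = (if x = b then a else x)"
  have \<xi>: "d \<xi> = 0" "a \<le> \<xi>" "\<xi> < b"
    using assms \<open>d x = 0\<close> by (auto simp: \<xi>_def)
  obtain e where e: "e > 0" "\<And>h. 0 < h \<Longrightarrow> \<xi> + h \<in> {a..b} \<Longrightarrow> h < e \<Longrightarrow> d \<xi> > d (\<xi> + h)"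
    using has_real_derivative_neg_dec_right[OF deriv[of \<xi>] zero[of \<xi>]] \<xi> by (metis atLeastAtMost_iff less_imp_le)
  define h where "h = min (e / 2) (b - \<xi>)"
  have h: "0 < h" "h < e" "\<xi> + h \<le> b"
    using e \<xi> by (auto simp: h_def min_def)
  have "d (\<xi> + h) < 0" using e(2)[of h] h \<xi> by auto
  then have "d a < 0"
    unfolding \<open>d a = d b\<close> using h \<xi> by - (rule stays_negative[where d = d and d' = d' and \<xi> = "\<xi> + h", OF deriv zero], auto)
  then have "d \<xi> < 0"
    using \<xi> by - (rule stays_negative[where d = d and d' = d' and \<xi> = a, OF deriv zero], auto)
  then show False using \<xi> by simp
qed

section \<open>Boundary value problems without uniqueness\<close>

primrec euler :: "(real \<Rightarrow> 'a \<Rightarrow> 'a) \<Rightarrow> real \<Rightarrow> 'a \<Rightarrow> nat \<Rightarrow> 'a::real_normed_vector" where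
  "euler F h z 0 = z"
| "euler F h z (Suc j) = euler F h z j + h *\<^sub>R F (real j * h) (euler F h z j)"

definition polygon :: "(real \<Rightarrow> 'a \<Rightarrow> 'a) \<Rightarrow> real \<Rightarrow> 'a \<Rightarrow> real \<Rightarrow> 'a::real_normed_vector" where
  "polygon F h z x =
     (let j = nat \<lfloor>x / h\<rfloor> in euler F h z j + (x - real j * h) *\<^sub>R F (real j * h) (euler F h z j))"

lemma polygon_grid:
  assumes "h > 0"
  shows "polygon F h z (real j * h) = euler F h z j"
  using assms by (simp add: polygon_def Let_def)

text \<open>The slope of the polygon on a cell is the value of \<open>F\<close> at its left grid
  point, which may precede \<open>x\<close> by almost \<open>h\<close>; hence the range of
  \<open>j\<close>. With \<open>f = 0\<close> this is a Lipschitz bound; with \<open>f\<close> a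
  nearby value of \<open>F\<close> it says that the polygon almost solves the equation.\<close>

lemma polygon_increment:
  assumes "h > 0" "0 \<le> x" "x \<le> x'" "\<epsilon> \<ge> 0"
    and close: "\<And>j. \<lbrakk>x - h < real j * h; real j * h \<le> x'\<rbrakk>
      \<Longrightarrow> norm (F (real j * h) (euler F h z j) - f) \<le> \<epsilon>"
  shows "norm (polygon F h z x' - polygon F h z x - (x' - x) *\<^sub>R f) \<le> \<epsilon> * (x' - x)"
proof -
  define e where "e = euler F h z"
  define D where "D j = F (real j * h) (e j)" for j
  define i where "i = nat \<lfloor>x / h\<rfloor>"
  define i' where "i' = nat \<lfloor>x' / h\<rfloor>"
  have e_Suc: "e (Suc j) = e j + h *\<^sub>R D j" for j
    by (simp add: e_def D_def)
  have floor_bounds: "real (nat \<lfloor>t / h\<rfloor>) * h \<le> t" "t < real (nat \<lfloor>t / h\<rfloor>) * h + h" if "t \<ge> 0" for t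
  proof -
    have "real (nat \<lfloor>t / h\<rfloor>) = of_int \<lfloor>t / h\<rfloor>"
      using that assms by simp
    moreover have "of_int \<lfloor>t / h\<rfloor> * h \<le> t / h * h" "t / h * h < (of_int \<lfloor>t / h\<rfloor> + 1) * h"
      using assms by (intro mult_right_mono mult_strict_right_mono; linarith)+
    ultimately show "real (nat \<lfloor>t / h\<rfloor>) * h \<le> t" "t < real (nat \<lfloor>t / h\<rfloor>) * h + h"
      using assms by (simp_all add: distrib_right)
  qed
  have i: "real i * h \<le> x" "x < real i * h + h" and i': "real i' * h \<le> x'" "x' < real i' * h + h"
    using floor_bounds[of x] floor_bounds[of x'] assms by (auto simp: i_def i'_def)
  have "i \<le> i'"
    unfolding i_def i'_def using assms by (intro nat_mono floor_mono divide_right_mono) auto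
  have near: "norm (D j - f) \<le> \<epsilon>" if "i \<le> j" "j \<le> i'" for j
  proof -
    have "real i * h \<le> real j * h" "real j * h \<le> real i' * h"
      using that assms by auto
    then have "x - h < real j * h" "real j * h \<le> x'" using i i' by linarith+
    then show ?thesis unfolding D_def e_def by (rule close)
  qed
  have poly: "polygon F h z x = e i + (x - real i * h) *\<^sub>R D i"
      "polygon F h z x' = e i' + (x' - real i' * h) *\<^sub>R D i'"
    by (simp_all add: polygon_def Let_def e_def D_def i_def i'_def)
  have scaled: "norm (c *\<^sub>R (D j - f)) \<le> \<epsilon> * c" if "i \<le> j" "j \<le> i'" "c \<ge> 0" for c j
    using mult_right_mono[OF near[of j] \<open>c \<ge> 0\<close>] that by (simp add: mult.commute)
  show ?thesis
  proof (cases "i = i'")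
    case True
    have "polygon F h z x' - polygon F h z x - (x' - x) *\<^sub>R f = (x' - x) *\<^sub>R (D i - f)"
      unfolding poly True by (simp add: algebra_simps)
    then show ?thesis using scaled[of i "x' - x"] True assms by simp
  next
    case False
    have steps: "norm (e (Suc i + k) - e (Suc i) - (real k * h) *\<^sub>R f) \<le> \<epsilon> * (real k * h)"
      if "Suc i + k \<le> i'" for k
      using that
    proof (induction k)
      case (Suc k)
      have "e (Suc i + Suc k) - e (Suc i) - (real (Suc k) * h) *\<^sub>R f
          = (e (Suc i + k) - e (Suc i) - (real k * h) *\<^sub>R f) + h *\<^sub>R (D (Suc i + k) - f)"
        using e_Suc[of "Suc i + k"] by (simp add: algebra_simps)
      also have "norm \<dots> \<le> \<epsilon> * (real k * h) + \<epsilon> * h"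
        using Suc assms by (intro norm_triangle_mono scaled) auto
      finally show ?case by (simp add: algebra_simps)
    qed simp
    define k where "k = i' - Suc i"
    have i'_eq: "i' = Suc i + k" using False \<open>i \<le> i'\<close> by (simp add: k_def)
    \<comment> \<open>The summands are the last partial cell, the \<open>k\<close> whole cells
      between, and the remainder of the first cell.\<close>
    have "polygon F h z x' - polygon F h z x - (x' - x) *\<^sub>R f
        = (x' - real i' * h) *\<^sub>R (D i' - f) + (e i' - e (Suc i) - (real k * h) *\<^sub>R f)
          + (real i * h + h - x) *\<^sub>R (D i - f)"
      unfolding poly e_Suc by (simp add: i'_eq algebra_simps)
    also have "norm \<dots> \<le> \<epsilon> * (x' - real i' * h) + \<epsilon> * (real k * h) + \<epsilon> * (real i * h + h - x)"
      using steps[of k] i i' i'_eq by (intro norm_triangle_mono scaled) auto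
    also have "\<dots> = \<epsilon> * (x' - x)" by (simp add: i'_eq algebra_simps)
    finally show ?thesis .
  qed
qed

text \<open>The end point of an Euler polygon depends continuously on its starting point even though the
  initial value problem need not be uniquely solvable. So Brouwer's theorem applies to the polygons,
  and the boundary condition survives their limit.\<close>
theorem ode_boundary_fixpoint:
  fixes F :: "real \<Rightarrow> 'a \<Rightarrow> 'a::euclidean_space"
  assumes "T > 0"
    and contF: "continuous_on ({0..T} \<times> UNIV) (\<lambda>(x, z). F x z)"
    and bound: "\<And>x z. x \<in> {0..T} \<Longrightarrow> norm (F x z) \<le> B"
    and K: "compact K" "convex K" "K \<noteq> {}"
    and contH: "continuous_on (K \<times> UNIV) (\<lambda>(z, z'). H z z')"
    and H: "\<And>z z'. z \<in> K \<Longrightarrow> H z z' \<in> K"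
  obtains Z where "\<And>x. x \<in> {0..T} \<Longrightarrow> (Z has_vector_derivative F x (Z x)) (at x within {0..T})"
    and "Z 0 \<in> K" and "H (Z 0) (Z T) = Z 0"
proof -
  have contFx: "continuous_on UNIV (F x)" if "x \<in> {0..T}" for x
  proof -
    have "continuous_on UNIV (\<lambda>z::'a. (x, z))" by (intro continuous_intros)
    moreover have "range (\<lambda>z::'a. (x, z)) \<subseteq> {0..T} \<times> UNIV" using that by auto
    ultimately show ?thesis
      using continuous_on_compose2[OF contF, of UNIV "\<lambda>z. (x, z)"] by simp
  qed
  \<comment> \<open>An even division makes T a grid point, so the end point of the polygon is an
    Euler value.\<close>
  define h where "h n = T / real (Suc n)" for n
  have h: "h n > 0" "real (Suc n) * h n = T" for n
    using \<open>T > 0\<close> by (auto simp: h_def)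
  have grid: "real j * h n \<in> {0..T}" if "j \<le> Suc n" for j n
  proof -
    have "real j * h n \<le> real (Suc n) * h n" using that h(1)[of n] by (intro mult_right_mono) auto
    then show ?thesis using h(1)[of n] unfolding h(2) by simp
  qed
  have cont_euler: "continuous_on UNIV (\<lambda>z. euler F (h n) z j)" if "j \<le> Suc n" for j n
    using that
  proof (induction j)
    case (Suc j)
    then have "continuous_on UNIV (\<lambda>z. F (real j * h n) (euler F (h n) z j))"
      by (intro continuous_on_compose2[OF contFx[OF grid]]) auto
    then show ?case using Suc by (auto intro!: continuous_intros)
  qed (simp add: continuous_on_id)
  have "\<exists>\<zeta>\<in>K. H \<zeta> (euler F (h n) \<zeta> (Suc n)) = \<zeta>" for n
  proof -
    have "continuous_on K (\<lambda>z. (z, euler F (h n) z (Suc n)))"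
      by (intro continuous_on_Pair continuous_on_id continuous_on_subset[OF cont_euler[OF order_refl]]) auto
    then have "continuous_on K (\<lambda>z. H z (euler F (h n) z (Suc n)))"
      using continuous_on_compose2[OF contH, of K "\<lambda>z. (z, euler F (h n) z (Suc n))"] by auto
    moreover have "(\<lambda>z. H z (euler F (h n) z (Suc n))) \<in> K \<rightarrow> K" using H by blast
    ultimately show ?thesis by (rule brouwer[OF K]) blast
  qed
  then obtain \<zeta> where \<zeta>: "\<And>n. \<zeta> n \<in> K" "\<And>n. H (\<zeta> n) (euler F (h n) (\<zeta> n) (Suc n)) = \<zeta> n"
    by metis
  define P where "P n = polygon F (h n) (\<zeta> n)" for n
  have P_grid: "P n (real j * h n) = euler F (h n) (\<zeta> n) j" for n j
    unfolding P_def by (rule polygon_grid[OF h(1)])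
  have P0: "P n 0 = \<zeta> n" for n using P_grid[of n 0] by simp
  have PT: "P n T = euler F (h n) (\<zeta> n) (Suc n)" for n
    using P_grid[of n "Suc n"] unfolding h(2) .
  have "0 \<le> B" using order_trans[OF norm_ge_zero bound[of 0 0]] \<open>T > 0\<close> by simp
  have grid_le: "j \<le> Suc n" if "real j * h n \<le> T" for j n
  proof (rule ccontr)
    assume "\<not> j \<le> Suc n"
    then have "real (Suc n) * h n < real j * h n" using h[of n] by (intro mult_strict_right_mono) auto
    then show False using that h(2)[of n] by simp
  qed
  have lip0: "norm (P n x' - P n x) \<le> B * (x' - x)" if "0 \<le> x" "x \<le> x'" "x' \<le> T" for n x x'
  proof -
    have "norm (polygon F (h n) (\<zeta> n) x' - polygon F (h n) (\<zeta> n) x - (x' - x) *\<^sub>R 0) \<le> B * (x' - x)"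
    proof (rule polygon_increment)
      fix j assume "real j * h n \<le> x'"
      then have "real j * h n \<in> {0..T}" using that by (intro grid grid_le) simp
      then show "norm (F (real j * h n) (euler F (h n) (\<zeta> n) j) - 0) \<le> B" by (simp add: bound)
    qed (use that \<open>0 \<le> B\<close> h(1) in auto)
    then show ?thesis by (simp add: P_def)
  qed
  have lip: "norm (P n x' - P n x) \<le> B * \<bar>x' - x\<bar>" if "x \<in> {0..T}" "x' \<in> {0..T}" for n x x'
    using lip0[of x x' n] lip0[of x' x n] that by (cases "x \<le> x'") (auto simp: norm_minus_commute)
  obtain \<rho>0 where \<rho>0: "\<And>z. z \<in> K \<Longrightarrow> norm z \<le> \<rho>0"
    using compact_imp_bounded[OF K(1)] by (auto simp: bounded_iff)
  define \<rho> where "\<rho> = \<rho>0 + B * T"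
  have P_bound: "norm (P n x) \<le> \<rho>" if "x \<in> {0..T}" for n x
  proof -
    have "norm (P n x) \<le> norm (P n 0) + norm (P n x - P n 0)" by (rule norm_triangle_sub)
    also have "\<dots> \<le> \<rho>0 + B * (x - 0)"
      using \<rho>0[OF \<zeta>(1)[of n]] lip0[of 0 x n] that P0[of n] by (intro add_mono) auto
    also have "\<dots> \<le> \<rho>0 + B * T"
      using that \<open>0 \<le> B\<close> by (simp add: mult_left_mono)
    finally show ?thesis by (simp add: \<rho>_def)
  qed
  obtain Z k where "continuous_on {0..T} Z" and k: "strict_mono (k :: nat \<Rightarrow> nat)"
    and unif: "\<And>e. 0 < e \<Longrightarrow> \<exists>N. \<forall>n x. n \<ge> N \<and> x \<in> {0..T} \<longrightarrow> norm (P (k n) x - Z x) < e"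
  proof (rule Arzela_Ascoli[of "{0..T}" P \<rho>])
    fix x e :: real assume "x \<in> {0..T}" "0 < e"
    have "norm (P n x - P n y) < e" if "y \<in> {0..T}" "norm (x - y) < e / (B + 1)" for n y
    proof -
      have "norm (P n x - P n y) \<le> B * \<bar>x - y\<bar>" using lip \<open>x \<in> {0..T}\<close> that by blast
      also have "\<dots> \<le> (B + 1) * \<bar>x - y\<bar>" by (intro mult_right_mono) auto
      also have "\<dots> < e" using that \<open>0 \<le> B\<close> by (simp add: field_simps)
      finally show ?thesis .
    qed
    then show "\<exists>d>0. \<forall>n y. y \<in> {0..T} \<and> norm (x - y) < d \<longrightarrow> norm (P n x - P n y) < e"
      using \<open>0 \<le> B\<close> \<open>0 < e\<close> by (intro exI[of _ "e / (B + 1)"]) auto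
  qed (use P_bound in auto)
  have lim: "(\<lambda>n. P (k n) x) \<longlonglongrightarrow> Z x" if "x \<in> {0..T}" for x
    using unif that by (fastforce simp: LIMSEQ_iff)
  \<comment> \<open>An approximate difference quotient, uniform in n, survives the pointwise limit
    without any integral equation. The free sample point \<xi> may be either end of the interval,
    which later gives both one-sided derivatives.\<close>
  have approx: "\<exists>\<delta>>0. \<forall>\<^sub>F n in sequentially. \<forall>x\<in>{0..T}. \<forall>x'\<in>{0..T}. \<forall>\<xi>\<in>{x..x'}. x' - x < \<delta> \<longrightarrow>
      norm (P n x' - P n x - (x' - x) *\<^sub>R F \<xi> (P n \<xi>)) \<le> \<epsilon> * (x' - x)" if "\<epsilon> > 0" for \<epsilon>
  proof -
    have "uniformly_continuous_on ({0..T} \<times> cball 0 \<rho>) (\<lambda>(x, z). F x z)"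
      by (intro compact_uniformly_continuous compact_Times compact_Icc compact_cball
          continuous_on_subset[OF contF]) auto
    then obtain d where "d > 0" and d: "\<And>s t z z'. \<lbrakk>s \<in> {0..T}; t \<in> {0..T}; z \<in> cball 0 \<rho>; z' \<in> cball 0 \<rho>;
        dist (s, z) (t, z') < d\<rbrakk> \<Longrightarrow> dist (F s z) (F t z') < \<epsilon>"
      unfolding uniformly_continuous_on_def using \<open>\<epsilon> > 0\<close> by fast
    \<comment> \<open>A relevant grid point is within \<open>2 * \<delta>\<close> of \<xi>, and the
      polygons are Lipschitz with constant \<open>B\<close>, so the points of the graph are within
      \<open>(1 + B) * 2 * \<delta> = d / 2\<close>.\<close>
    define \<delta> where "\<delta> = d / (4 * (1 + B))"
    have "\<delta> > 0" using \<open>d > 0\<close> \<open>0 \<le> B\<close> by (simp add: \<delta>_def)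
    have "h \<longlonglongrightarrow> 0" unfolding h_def by (rule LIMSEQ_Suc[OF lim_const_over_n])
    then have "\<forall>\<^sub>F n in sequentially. h n < \<delta>" by (rule order_tendstoD) fact
    then have "\<forall>\<^sub>F n in sequentially. \<forall>x\<in>{0..T}. \<forall>x'\<in>{0..T}. \<forall>\<xi>\<in>{x..x'}. x' - x < \<delta> \<longrightarrow>
      norm (P n x' - P n x - (x' - x) *\<^sub>R F \<xi> (P n \<xi>)) \<le> \<epsilon> * (x' - x)"
    proof (eventually_elim, intro ballI impI)
      fix n x x' \<xi> assume hn: "h n < \<delta>" and x: "x \<in> {0..T}" "x' \<in> {0..T}" "\<xi> \<in> {x..x'}" "x' - x < \<delta>"
      show "norm (P n x' - P n x - (x' - x) *\<^sub>R F \<xi> (P n \<xi>)) \<le> \<epsilon> * (x' - x)"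
        unfolding P_def
      proof (rule polygon_increment)
        fix j assume j: "x - h n < real j * h n" "real j * h n \<le> x'"
        define s where "s = real j * h n"
        have s: "s \<in> {0..T}" "\<bar>s - \<xi>\<bar> < 2 * \<delta>" using j x h(1)[of n] hn by (auto simp: s_def)
        have "dist (s, P n s) (\<xi>, P n \<xi>) \<le> dist s \<xi> + dist (P n s) (P n \<xi>)"
          using sqrt_sum_squares_le_sum[of "dist s \<xi>" "dist (P n s) (P n \<xi>)"] by (simp add: dist_Pair_Pair)
        also have "\<dots> \<le> (1 + B) * \<bar>s - \<xi>\<bar>"
          using lip[of \<xi> s n] s x by (auto simp: dist_norm algebra_simps)
        also have "\<dots> < (1 + B) * (2 * \<delta>)" using s \<open>0 \<le> B\<close> by (intro mult_strict_left_mono) auto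
        also have "\<dots> \<le> d" using \<open>d > 0\<close> \<open>0 \<le> B\<close> by (simp add: \<delta>_def field_simps)
        finally have "dist (F s (P n s)) (F \<xi> (P n \<xi>)) < \<epsilon>"
          using s x by (intro d) (auto simp: P_bound)
        then show "norm (F (real j * h n) (euler F (h n) (\<zeta> n) j) - F \<xi> (polygon F (h n) (\<zeta> n) \<xi>)) \<le> \<epsilon>"
          using P_grid[of n j] by (simp add: s_def dist_norm P_def)
      qed (use x h(1)[of n] \<open>\<epsilon> > 0\<close> in auto)
    qed
    then show ?thesis using \<open>\<delta> > 0\<close> by blast
  qed
  have limit: "\<exists>\<delta>>0. \<forall>x\<in>{0..T}. \<forall>x'\<in>{0..T}. \<forall>\<xi>\<in>{x..x'}. x' - x < \<delta> \<longrightarrow>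
      norm (Z x' - Z x - (x' - x) *\<^sub>R F \<xi> (Z \<xi>)) \<le> \<epsilon> * (x' - x)" if "\<epsilon> > 0" for \<epsilon>
  proof -
    from approx[OF that] obtain \<delta> where "\<delta> > 0"
      and \<delta>: "\<forall>\<^sub>F n in sequentially. \<forall>x\<in>{0..T}. \<forall>x'\<in>{0..T}. \<forall>\<xi>\<in>{x..x'}. x' - x < \<delta> \<longrightarrow>
        norm (P n x' - P n x - (x' - x) *\<^sub>R F \<xi> (P n \<xi>)) \<le> \<epsilon> * (x' - x)"
      by blast
    have "norm (Z x' - Z x - (x' - x) *\<^sub>R F \<xi> (Z \<xi>)) \<le> \<epsilon> * (x' - x)"
      if x: "x \<in> {0..T}" "x' \<in> {0..T}" "\<xi> \<in> {x..x'}" "x' - x < \<delta>" for x x' \<xi>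
    proof (rule tendsto_upperbound)
      have \<xi>: "\<xi> \<in> {0..T}" using x by auto
      have "isCont (F \<xi>) (Z \<xi>)"
        using contFx[OF \<xi>] by (simp add: continuous_on_eq_continuous_at)
      then have "(\<lambda>n. F \<xi> (P (k n) \<xi>)) \<longlonglongrightarrow> F \<xi> (Z \<xi>)"
        using lim[OF \<xi>] by (rule isCont_tendsto_compose)
      then show "(\<lambda>n. norm (P (k n) x' - P (k n) x - (x' - x) *\<^sub>R F \<xi> (P (k n) \<xi>)))
          \<longlonglongrightarrow> norm (Z x' - Z x - (x' - x) *\<^sub>R F \<xi> (Z \<xi>))"
        using x by (intro tendsto_intros lim)
      show "\<forall>\<^sub>F n in sequentially.
          norm (P (k n) x' - P (k n) x - (x' - x) *\<^sub>R F \<xi> (P (k n) \<xi>)) \<le> \<epsilon> * (x' - x)"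
      proof -
        have "\<forall>\<^sub>F n in sequentially. norm (P n x' - P n x - (x' - x) *\<^sub>R F \<xi> (P n \<xi>)) \<le> \<epsilon> * (x' - x)"
          using \<delta> by (rule eventually_mono) (simp only: x)
        then show ?thesis
          by (rule eventually_subseq[OF k])
      qed
    qed simp
    then show ?thesis using \<open>\<delta> > 0\<close> by (intro exI[of _ \<delta>]) simp
  qed
  have deriv: "(Z has_vector_derivative F x (Z x)) (at x within {0..T})" if x: "x \<in> {0..T}" for x
    unfolding has_vector_derivative_def has_derivative_within_alt
  proof (intro conjI allI impI bounded_linear_scaleR_left)
    fix e :: real assume "e > 0"
    from limit[OF this] obtain \<delta> where "\<delta> > 0"
      and \<delta>: "\<And>x x' \<xi>. \<lbrakk>x \<in> {0..T}; x' \<in> {0..T}; \<xi> \<in> {x..x'}; x' - x < \<delta>\<rbrakk>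
        \<Longrightarrow> norm (Z x' - Z x - (x' - x) *\<^sub>R F \<xi> (Z \<xi>)) \<le> e * (x' - x)"
      by metis
    have "norm (Z y - Z x - (y - x) *\<^sub>R F x (Z x)) \<le> e * norm (y - x)"
      if "y \<in> {0..T}" "norm (y - x) < \<delta>" for y
    proof (cases "x \<le> y")
      case True
      then show ?thesis using \<delta>[of x y x] x that by auto
    next
      case False
      have "Z y - Z x - (y - x) *\<^sub>R F x (Z x) = - (Z x - Z y - (x - y) *\<^sub>R F x (Z x))"
        by (simp add: algebra_simps)
      then show ?thesis using \<delta>[of y x x] x that False by (simp only: norm_minus_cancel) auto
    qed
    then show "\<exists>d>0. \<forall>y\<in>{0..T}. norm (y - x) < d \<longrightarrow>
        norm (Z y - Z x - (y - x) *\<^sub>R F x (Z x)) \<le> e * norm (y - x)"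
      using \<open>\<delta> > 0\<close> by blast
  qed
  have lim0: "(\<lambda>n. \<zeta> (k n)) \<longlonglongrightarrow> Z 0" using lim[of 0] \<open>T > 0\<close> by (simp add: P0)
  then have "Z 0 \<in> K"
    using closed_sequentially[OF compact_imp_closed[OF K(1)]] \<zeta>(1) by metis
  moreover have "H (Z 0) (Z T) = Z 0"
  proof (rule LIMSEQ_unique)
    have "(\<lambda>n. (\<zeta> (k n), P (k n) T)) \<longlonglongrightarrow> (Z 0, Z T)"
      using lim0 lim[of T] \<open>T > 0\<close> by (intro tendsto_Pair) auto
    then have "(\<lambda>n. (\<lambda>(z, z'). H z z') (\<zeta> (k n), P (k n) T)) \<longlonglongrightarrow> (\<lambda>(z, z'). H z z') (Z 0, Z T)"
      using \<open>Z 0 \<in> K\<close> \<zeta>(1) by (intro continuous_on_tendsto_compose[OF contH]) auto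
    then show "(\<lambda>n. \<zeta> (k n)) \<longlonglongrightarrow> H (Z 0) (Z T)"
      by (simp only: prod.case PT \<zeta>(2))
  qed (rule lim0)
  ultimately show ?thesis using that deriv by blast
qed

section \<open>Principal eigenvalues in logarithmic form\<close>

lemma DERIV_within_decreasing:
  fixes d d' :: "real \<Rightarrow> real"
  assumes deriv: "\<And>x. x \<in> {a..b} \<Longrightarrow> (d has_real_derivative d' x) (at x within {a..b})"
    and neg: "\<And>x. x \<in> {a..b} \<Longrightarrow> d' x < 0" and "a < b"
  shows "d b < d a"
proof (rule DERIV_neg_imp_decreasing_open[OF \<open>a < b\<close>])
  fix x assume x: "a < x" "x < b"
  then have "(d has_real_derivative d' x) (at x)"
    using deriv[of x] at_within_Icc_at[of a x b] by simp
  then show "\<exists>y. (d has_real_derivative y) (at x) \<and> y < 0" using neg[of x] x by auto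
qed (rule DERIV_continuous_on[OF deriv])

lemma DERIV_within_increasing:
  fixes d d' :: "real \<Rightarrow> real"
  assumes deriv: "\<And>x. x \<in> {a..b} \<Longrightarrow> (d has_real_derivative d' x) (at x within {a..b})"
    and pos: "\<And>x. x \<in> {a..b} \<Longrightarrow> d' x > 0" and "a < b"
  shows "d a < d b"
  using DERIV_within_decreasing[of a b "\<lambda>x. - d x" "\<lambda>x. - d' x"] assms
  by (auto intro: DERIV_minus)

lemma periodic_derivative_zero:
  fixes d d' :: "real \<Rightarrow> real"
  assumes deriv: "\<And>x. x \<in> {a..b} \<Longrightarrow> (d has_real_derivative d' x) (at x within {a..b})"
    and "d a = d b" "a < b"
  obtains z where "z \<in> {a..b}" "d' z = 0"
proof -
  have at: "(d has_real_derivative d' x) (at x)" if "a < x" "x < b" for x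
    using deriv[of x] at_within_Icc_at[of a x b] that by simp
  have "\<exists>z>a. z < b \<and> DERIV d z :> 0"
  proof (rule Rolle[OF \<open>a < b\<close> \<open>d a = d b\<close> DERIV_continuous_on[OF deriv]])
    show "d differentiable at x" if "a < x" "x < b" for x
      using at[OF that] by (auto simp: real_differentiable_def)
  qed
  then obtain z where "a < z" "z < b" "DERIV d z :> 0" by blast
  then have "d' z = 0" using at DERIV_unique by blast
  then show ?thesis using that[of z] \<open>a < z\<close> \<open>z < b\<close> by simp
qed

text \<open>If \<open>\<mu> > A\<close>, then \<open>w\<close> would be strictly decreasing; if
  \<open>\<mu> < - A\<close>, it would increase through every zero, and \<open>z\<close> is one.
  Hence \<open>a x - \<mu> \<le> 2 * A\<close>, so \<open>w\<close> could only decrease through the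
  levels \<open>R\<close> and \<open>- R\<close> and, being periodic, never meets them.
  \<open>N\<close> is abstract so that the bounds serve both for the power and for its
  truncation.\<close>

lemma periodic_riccati_bounds:
  fixes w a N :: "real \<Rightarrow> real"
  assumes "T > 0"
    and deriv: "\<And>x. x \<in> {0..T} \<Longrightarrow> (w has_real_derivative a x - \<mu> - N (w x)) (at x within {0..T})"
    and per: "w 0 = w T" and z: "z \<in> {0..T}" "w z = 0"
    and a: "\<And>x. x \<in> {0..T} \<Longrightarrow> \<bar>a x\<bar> \<le> A"
    and N: "\<And>t. N t \<ge> 0" "N 0 = 0" "N R > 2 * A" "N (- R) > 2 * A" and "R > 0"
  shows "\<bar>\<mu>\<bar> \<le> A" and "\<And>x. x \<in> {0..T} \<Longrightarrow> \<bar>w x\<bar> < R"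
proof -
  have "\<mu> \<le> A"
  proof (rule ccontr)
    assume "\<not> \<mu> \<le> A"
    then have "a x - \<mu> - N (w x) < 0" if "x \<in> {0..T}" for x
      using a[OF that] N(1)[of "w x"] by linarith
    then show False using DERIV_within_decreasing[OF deriv _ \<open>T > 0\<close>] per by simp
  qed
  moreover have "\<mu> \<ge> - A"
  proof (rule ccontr)
    assume *: "\<not> \<mu> \<ge> - A"
    have "- w z \<noteq> 0"
    proof (rule periodic_no_crossing[where d = "\<lambda>x. - w x" and d' = "\<lambda>x. - (a x - \<mu> - N (w x))"])
      show "((\<lambda>x. - w x) has_real_derivative - (a x - \<mu> - N (w x))) (at x within {0..T})"
        if "x \<in> {0..T}" for x using deriv[OF that] by (rule DERIV_minus)
      show "- (a x - \<mu> - N (w x)) < 0" if "x \<in> {0..T}" "- w x = 0" for x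
        using a[OF that(1)] that N(2) * by simp
    qed (use z per \<open>T > 0\<close> in auto)
    then show False using z by simp
  qed
  ultimately show mu: "\<bar>\<mu>\<bar> \<le> A" by linarith
  have cont: "continuous_on {0..T} w" by (rule DERIV_continuous_on[OF deriv])
  have avoid: "w x \<noteq> r" if r: "N r > 2 * A" and x: "x \<in> {0..T}" for r x
  proof -
    have "w x - r \<noteq> 0"
    proof (rule periodic_no_crossing[where d = "\<lambda>x. w x - r" and d' = "\<lambda>x. a x - \<mu> - N (w x)"])
      show "((\<lambda>x. w x - r) has_real_derivative a x - \<mu> - N (w x)) (at x within {0..T})"
        if "x \<in> {0..T}" for x using deriv[OF that] by (auto intro!: derivative_eq_intros)
      show "a x - \<mu> - N (w x) < 0" if "x \<in> {0..T}" "w x - r = 0" for x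
        using a[OF that(1)] that r mu by simp
    qed (use x per \<open>T > 0\<close> in auto)
    then show ?thesis by simp
  qed
  have "connected (w ` {0..T})" using cont connected_Icc by (rule connected_continuous_image)
  then have conn: "t \<in> w ` {0..T}" if "s \<in> w ` {0..T}" "r \<in> w ` {0..T}" "s \<le> t" "t \<le> r" for s t r
    using that unfolding connected_iff_interval by blast
  have "0 \<in> w ` {0..T}" using imageI[OF z(1), of w] z(2) by simp
  moreover have "R \<notin> w ` {0..T}" "- R \<notin> w ` {0..T}"
    by (metis N(3) avoid imageE, metis N(4) avoid imageE)
  ultimately have "\<not> R \<le> w x" "\<not> w x \<le> - R" if "x \<in> {0..T}" for x
    using conn[of 0 "w x" R] conn[of "w x" 0 "- R"] imageI[OF that, of w] \<open>R > 0\<close> by force+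
  then show "\<bar>w x\<bar> < R" if "x \<in> {0..T}" for x
    using that by force
qed

text \<open>The substitution \<open>u = exp y\<close>, \<open>\<phi>\<^sub>p(u') / \<phi>\<^sub>p(u) = w\<close> turns a positive periodic solution of
  \<open>-(\<phi>\<^sub>p(u'))' + a \<phi>\<^sub>p(u) = \<mu> \<phi>\<^sub>p(u)\<close> into a periodic solution of a first order system in which
  \<open>y\<close> does not occur if \<open>a\<close> is given.\<close>
definition log_eigen ::
  "real \<Rightarrow> real \<Rightarrow> (real \<Rightarrow> real) \<Rightarrow> real \<Rightarrow> (real \<Rightarrow> real) \<Rightarrow> (real \<Rightarrow> real) \<Rightarrow> bool" where
  "log_eigen p T a \<mu> y w \<longleftrightarrow>
     (\<forall>x\<in>{0..T}. (y has_real_derivative phi (p / (p - 1)) (w x)) (at x within {0..T})) \<and>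
     (\<forall>x\<in>{0..T}. (w has_real_derivative a x - \<mu> - (p - 1) * \<bar>w x\<bar> powr (p / (p - 1)))
        (at x within {0..T})) \<and>
     y 0 = y T \<and> w 0 = w T"

text \<open>The barrier level for w: there the term
  \<open>(p - 1) * \<bar>w\<bar> powr (p / (p - 1))\<close> is \<open>2 * A + 1\<close>, exceeding
  the \<open>2 * A\<close> that the rest of the equation can contribute.\<close>

definition slope_bound :: "real \<Rightarrow> real \<Rightarrow> real" where
  "slope_bound p A = ((2 * A + 1) / (p - 1)) powr ((p - 1) / p)"

lemma slope_bound:
  assumes "p > 1" "A \<ge> 0"
  shows "slope_bound p A > 0" "(p - 1) * slope_bound p A powr (p / (p - 1)) = 2 * A + 1"
  using assms by (simp_all add: slope_bound_def powr_powr)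

lemma phi_eq_0_iff [simp]: "phi p s = 0 \<longleftrightarrow> s = 0"
  by (simp add: phi_def)

lemma abs_phi_mono:
  assumes "p > 1" "\<bar>s\<bar> \<le> t"
  shows "\<bar>phi p s\<bar> \<le> phi p t"
proof -
  have "\<bar>s\<bar> powr (p - 1) \<le> \<bar>t\<bar> powr (p - 1)" using assms by (intro powr_mono2) auto
  then show ?thesis using assms abs_phi[of p t] by (auto simp: abs_phi phi_sgn sgn_if)
qed

text \<open>A Harnack inequality for \<open>exp y\<close>: since y is periodic, w has a zero, so w
  lies below the barrier. The bound involves neither \<mu> nor the size of y.\<close>

lemma log_eigen_bounds:
  assumes "p > 1" "T > 0" and eig: "log_eigen p T a \<mu> y w"
    and a: "\<And>x. x \<in> {0..T} \<Longrightarrow> \<bar>a x\<bar> \<le> A" and "x \<in> {0..T}"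
  shows "\<bar>y x - y 0\<bar> \<le> phi (p / (p - 1)) (slope_bound p A) * T"
proof -
  have r: "p / (p - 1) > 1" using \<open>p > 1\<close> by simp
  have "A \<ge> 0" using a[of 0] \<open>T > 0\<close> by auto
  have y: "(y has_real_derivative phi (p / (p - 1)) (w x)) (at x within {0..T})" if "x \<in> {0..T}" for x
    using eig that by (simp add: log_eigen_def)
  obtain z where z: "z \<in> {0..T}" "w z = 0"
    using periodic_derivative_zero[OF y] eig \<open>T > 0\<close> by (auto simp: log_eigen_def)
  have w: "\<bar>w x\<bar> < slope_bound p A" if "x \<in> {0..T}" for x
    using periodic_riccati_bounds(2)[of T w a \<mu> "\<lambda>t. (p - 1) * \<bar>t\<bar> powr (p / (p - 1))" z A "slope_bound p A" x]
      eig z that assms slope_bound[OF \<open>p > 1\<close> \<open>A \<ge> 0\<close>] by (auto simp: log_eigen_def)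
  have "\<bar>phi (p / (p - 1)) (w x)\<bar> \<le> phi (p / (p - 1)) (slope_bound p A)" if "x \<in> {0..T}" for x
    using w[OF that] by (intro abs_phi_mono r) simp
  then have "norm (y x - y 0) \<le> phi (p / (p - 1)) (slope_bound p A) * norm (x - 0)"
    using \<open>T > 0\<close> \<open>x \<in> {0..T}\<close> by (intro field_differentiable_bound[OF convex_real_interval(5) y]) auto
  also have "\<dots> \<le> phi (p / (p - 1)) (slope_bound p A) * T"
    using \<open>x \<in> {0..T}\<close> slope_bound(1)[OF \<open>p > 1\<close> \<open>A \<ge> 0\<close>]
    by (intro mult_left_mono) (auto simp: phi_pos)
  finally show ?thesis by simp
qed

text \<open>If one right-hand side were strictly larger throughout, \<open>w1 - w2\<close> would
  have no zero. But the periodic function \<open>y1 - y2\<close> has a critical point, and there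
  \<open>w1 = w2\<close> because \<open>phi\<close> is injective.\<close>

lemma log_eigen_strict_compare:
  assumes "p > 1" "T > 0"
    and 1: "log_eigen p T a1 \<mu>1 y1 w1" and 2: "log_eigen p T a2 \<mu>2 y2 w2"
  shows "\<exists>x\<in>{0..T}. a2 x - \<mu>2 \<le> a1 x - \<mu>1"
proof (rule ccontr)
  assume "\<not> ?thesis"
  then have less: "a1 x - \<mu>1 < a2 x - \<mu>2" if "x \<in> {0..T}" for x using that by force
  let ?r = "p / (p - 1)"
  let ?d' = "\<lambda>x. (a1 x - \<mu>1 - (p - 1) * \<bar>w1 x\<bar> powr ?r) - (a2 x - \<mu>2 - (p - 1) * \<bar>w2 x\<bar> powr ?r)"
  have no_zero: "w1 x - w2 x \<noteq> 0" if "x \<in> {0..T}" for x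
  proof (rule periodic_no_crossing[where d = "\<lambda>x. w1 x - w2 x" and d' = ?d'])
    show "((\<lambda>x. w1 x - w2 x) has_real_derivative ?d' x) (at x within {0..T})" if "x \<in> {0..T}" for x
      using 1 2 that by (intro DERIV_diff) (auto simp: log_eigen_def)
    show "?d' x < 0" if "x \<in> {0..T}" "w1 x - w2 x = 0" for x
      using less[OF that(1)] that(2) by simp
  qed (use 1 2 \<open>T > 0\<close> that in \<open>auto simp: log_eigen_def\<close>)
  obtain z where "z \<in> {0..T}" "phi ?r (w1 z) - phi ?r (w2 z) = 0"
  proof (rule periodic_derivative_zero)
    show "((\<lambda>x. y1 x - y2 x) has_real_derivative phi ?r (w1 x) - phi ?r (w2 x)) (at x within {0..T})"
      if "x \<in> {0..T}" for x
      using 1 2 that by (intro DERIV_diff) (auto simp: log_eigen_def)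
    show "y1 0 - y2 0 = y1 T - y2 T" using 1 2 by (simp add: log_eigen_def)
  qed (use \<open>T > 0\<close> in auto)
  then show False
    using no_zero[of z] phi_strict_mono[of ?r "w1 z" "w2 z"] phi_strict_mono[of ?r "w2 z" "w1 z"] \<open>p > 1\<close>
    by (cases "w1 z < w2 z") (auto simp: less_le)
qed

text \<open>The strict comparison in both directions. The principal eigenvalue is thus unique
  (\<open>\<epsilon> = 0\<close>) and a Lipschitz function of the potential in the sup norm.\<close>

lemma log_eigen_compare:
  assumes "p > 1" "T > 0"
    and 1: "log_eigen p T a1 \<mu>1 y1 w1" and 2: "log_eigen p T a2 \<mu>2 y2 w2"
    and close: "\<And>x. x \<in> {0..T} \<Longrightarrow> \<bar>a1 x - a2 x\<bar> \<le> \<epsilon>"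
  shows "\<bar>\<mu>1 - \<mu>2\<bar> \<le> \<epsilon>"
  using log_eigen_strict_compare[OF assms(1,2) 1 2] log_eigen_strict_compare[OF assms(1,2) 2 1] close
  by (force simp: abs_le_iff)

section \<open>Truncation and existence of periodic solutions\<close>

definition clip :: "real \<Rightarrow> real \<Rightarrow> real" where
  "clip b t = max (- b) (min b t)"

lemma clip_bound: "b \<ge> 0 \<Longrightarrow> \<bar>clip b t\<bar> \<le> b"
  by (auto simp: clip_def)

lemma clip_in: "b \<ge> 0 \<Longrightarrow> clip b t \<in> {- b..b}"
  by (auto simp: clip_def)

lemma clip_id: "\<bar>t\<bar> \<le> b \<Longrightarrow> clip b t = t"
  by (auto simp: clip_def)

lemma clip_less_0_iff: "b > 0 \<Longrightarrow> clip b t < 0 \<longleftrightarrow> t < 0"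
  by (auto simp: clip_def)

lemma clip_gt_0_iff: "b > 0 \<Longrightarrow> clip b t > 0 \<longleftrightarrow> t > 0"
  by (auto simp: clip_def)

lemma continuous_on_clip [continuous_intros]:
  "continuous_on S g \<Longrightarrow> continuous_on S (\<lambda>x. clip b (g x))"
  unfolding clip_def by (intro continuous_intros)

text \<open>Here \<open>y\<close> is the logarithm of the unknown function. The eigenvalue \<open>\<mu>\<close> is a further unknown, and
  \<open>y 0\<close> is moved by \<open>\<sigma> \<mu>\<close> within \<open>[-C, C]\<close>. At a fixed point, \<open>\<mu> = 0\<close>
  unless \<open>y 0\<close> is stuck at an end of this interval.\<close>
theorem log_eigen_exists:
  fixes a :: "real \<Rightarrow> real \<Rightarrow> real"
  assumes "p > 1" "T > 0" "C \<ge> 0"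
    and conta: "continuous_on ({0..T} \<times> UNIV) (\<lambda>(x, y). a x y)"
    and a: "\<And>x y. x \<in> {0..T} \<Longrightarrow> \<bar>a x y\<bar> \<le> A"
  obtains \<mu> y w where "log_eigen p T (\<lambda>x. a x (y x)) \<mu> y w" "\<bar>y 0\<bar> \<le> C"
    "\<sigma> * \<mu> = 0 \<or> y 0 = C \<and> \<sigma> * \<mu> > 0 \<or> y 0 = - C \<and> \<sigma> * \<mu> < 0"
proof -
  define r where "r = p / (p - 1)"
  have r: "r > 1" using \<open>p > 1\<close> by (simp add: r_def)
  have "A \<ge> 0" using a[of 0] \<open>T > 0\<close> by (meson abs_ge_zero atLeastAtMost_iff less_imp_le order_refl order_trans)
  define R where "R = slope_bound p A"
  have R: "R > 0" "(p - 1) * R powr r = 2 * A + 1"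
    using slope_bound[OF \<open>p > 1\<close> \<open>A \<ge> 0\<close>] by (auto simp: R_def r_def)
  \<comment> \<open>This agrees with the true term as soon as \<open>|w| < R\<close>, which the a
    priori bound yields in the end.\<close>
  define N where "N t = (p - 1) * \<bar>clip R t\<bar> powr r" for t
  have N_le: "N t \<le> 2 * A + 1" for t
    unfolding N_def R(2)[symmetric] using \<open>p > 1\<close> r R(1)
    by (intro mult_left_mono powr_mono2) (auto simp: clip_bound)
  have N_ge: "N t \<ge> 0" for t using \<open>p > 1\<close> by (simp add: N_def)
  have N_R: "N R = 2 * A + 1" "N (- R) = 2 * A + 1" "N 0 = 0"
    using R by (auto simp: N_def clip_id)
  \<comment> \<open>As \<open>N\<close> lies between 0 and \<open>2 * A + 1\<close>, the derivative
    of w is negative for \<open>\<mu> = M\<close> and at least 1 for \<open>\<mu> = - M\<close>.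
    \<open>D\<close> bounds the slope of w, and \<open>W\<close> is so large that w keeps its sign
    on all of [0,T] if it starts at \<open>W\<close> or \<open>- W\<close>.\<close>
  define M where "M = 3 * A + 2"
  define D where "D = 6 * A + 3"
  define W where "W = D * T + R + 1"
  have nonneg: "M \<ge> 0" "D \<ge> 0" "W \<ge> 0" using \<open>A \<ge> 0\<close> \<open>T > 0\<close> R by (auto simp: M_def D_def W_def)
  \<comment> \<open>The parameter \<mu> is a state variable with derivative 0, so that it is
    selected together with the initial values of y and w.\<close>
  define F :: "real \<Rightarrow> real \<times> real \<times> real \<Rightarrow> real \<times> real \<times> real" where
    "F x z = (phi r (clip R (snd (snd z))), 0,
        a x (fst z) - clip M (fst (snd z)) - N (snd (snd z)))" for x z
  \<comment> \<open>The map moves \<open>y 0\<close> by \<open>\<sigma> * \<mu>\<close>, raises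
    \<mu> when w ends above its initial value, and lowers \<open>w 0\<close> when y does; clipping
    keeps the image in the box.\<close>
  define H :: "real \<times> real \<times> real \<Rightarrow> real \<times> real \<times> real \<Rightarrow> real \<times> real \<times> real" where
    "H z z' = (clip C (fst z + \<sigma> * fst (snd z)),
        clip M (fst (snd z) + (snd (snd z') - snd (snd z))),
        clip W (snd (snd z) - (fst z' - fst z)))" for z z'
  have slope: "\<bar>a x y - clip M \<mu> - N t\<bar> \<le> D" if "x \<in> {0..T}" for x y \<mu> t
    using a[OF that, of y] clip_bound[OF nonneg(1), of \<mu>] N_le[of t] N_ge[of t] \<open>A \<ge> 0\<close>
    by (simp add: D_def M_def)
  obtain Z where Z: "\<And>x. x \<in> {0..T} \<Longrightarrow> (Z has_vector_derivative F x (Z x)) (at x within {0..T})"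
    and "Z 0 \<in> {- C..C} \<times> {- M..M} \<times> {- W..W}" and HZ: "H (Z 0) (Z T) = Z 0"
  proof (rule ode_boundary_fixpoint[of T F "phi r R + D" "{- C..C} \<times> {- M..M} \<times> {- W..W}" H])
    have "continuous_on ({0..T} \<times> UNIV) (\<lambda>q::real \<times> real \<times> real \<times> real. a (fst q) (fst (snd q)))"
      using continuous_on_compose2[OF conta, of "{0..T} \<times> UNIV" "\<lambda>q::real \<times> real \<times> real \<times> real. (fst q, fst (snd q))"]
      by (force intro!: continuous_intros)
    then show "continuous_on ({0..T} \<times> UNIV) (\<lambda>(x, z). F x z)"
      unfolding F_def N_def case_prod_unfold using r
      by (intro continuous_intros) auto
    show "norm (F x z) \<le> phi r R + D" if "x \<in> {0..T}" for x z
    proof -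
      have "norm (F x z) \<le> \<bar>phi r (clip R (snd (snd z)))\<bar> +
          \<bar>a x (fst z) - clip M (fst (snd z)) - N (snd (snd z))\<bar>"
        unfolding F_def by (rule order_trans[OF norm_Pair_le]) (simp add: norm_Pair)
      also have "\<dots> \<le> phi r R + D"
        using slope[OF that] R(1) by (intro add_mono abs_phi_mono r clip_bound) auto
      finally show ?thesis .
    qed
    show "convex ({- C..C} \<times> {- M..M} \<times> {- W..W})"
      by (intro convex_Times convex_real_interval)
    show "continuous_on (({- C..C} \<times> {- M..M} \<times> {- W..W}) \<times> UNIV) (\<lambda>(z, z'). H z z')"
      unfolding H_def case_prod_unfold by (intro continuous_intros)
    show "H z z' \<in> {- C..C} \<times> {- M..M} \<times> {- W..W}" for z z'
      unfolding H_def using clip_in nonneg \<open>C \<ge> 0\<close> by (auto simp del: atLeastAtMost_iff)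
    show "compact ({- C..C} \<times> {- M..M} \<times> {- W..W})"
      by (intro compact_Times compact_Icc)
    show "{- C..C} \<times> {- M..M} \<times> {- W..W} \<noteq> {}"
      using \<open>C \<ge> 0\<close> nonneg by auto
  qed (rule \<open>T > 0\<close>, rule that)
  define y where "y x = fst (Z x)" for x
  define \<mu> where "\<mu> = fst (snd (Z 0))"
  define w where "w x = snd (snd (Z x))" for x
  have in_box: "\<bar>y 0\<bar> \<le> C" "\<bar>\<mu>\<bar> \<le> M" "\<bar>w 0\<bar> \<le> W"
    using \<open>Z 0 \<in> _\<close> by (auto simp: y_def \<mu>_def w_def mem_Times_iff)
  have fixed: "clip C (y 0 + \<sigma> * \<mu>) = y 0" "clip M (\<mu> + (w T - w 0)) = \<mu>" "clip W (w 0 - (y T - y 0)) = w 0"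
    using arg_cong[OF HZ, of fst] arg_cong[OF HZ, of "\<lambda>z. fst (snd z)"] arg_cong[OF HZ, of "\<lambda>z. snd (snd z)"]
    by (simp_all add: H_def y_def w_def \<mu>_def)
  have "((\<lambda>x. fst (snd (Z x))) has_real_derivative 0) (at x within {0..T})" if "x \<in> {0..T}" for x
    using bounded_linear.has_vector_derivative[OF bounded_linear_fst
        bounded_linear.has_vector_derivative[OF bounded_linear_snd Z[OF that]]]
    by (simp add: F_def has_real_derivative_iff_has_vector_derivative)
  then have mu: "fst (snd (Z x)) = \<mu>" if "x \<in> {0..T}" for x
    using has_field_derivative_zero_constant[OF convex_real_interval(5)[of 0 T], of "\<lambda>x. fst (snd (Z x))"]
      that \<open>T > 0\<close> unfolding \<mu>_def by fastforce
  have y: "(y has_real_derivative phi r (clip R (w x))) (at x within {0..T})" if "x \<in> {0..T}" for x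
    using bounded_linear.has_vector_derivative[OF bounded_linear_fst Z[OF that]]
    by (simp add: F_def has_real_derivative_iff_has_vector_derivative y_def[abs_def] w_def)
  have w: "(w has_real_derivative a x (y x) - \<mu> - N (w x)) (at x within {0..T})" if "x \<in> {0..T}" for x
    using bounded_linear.has_vector_derivative[OF bounded_linear_snd
        bounded_linear.has_vector_derivative[OF bounded_linear_snd Z[OF that]]] mu[OF that] in_box(2)
    by (simp add: F_def has_real_derivative_iff_has_vector_derivative y_def w_def[abs_def] clip_id)
  \<comment> \<open>A mismatch of w would keep pushing \<mu>, so at a fixed point \<mu> sits at the
    end of its range in that direction; there w moves strictly the other way.\<close>
  have w_per: "w 0 = w T"
  proof (rule ccontr)
    assume "w 0 \<noteq> w T"
    then consider "w T > w 0" | "w T < w 0" by linarith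
    then show False
    proof cases
      case 1
      then have "\<mu> = M" using fixed(2) in_box(2) by (auto simp: clip_def max_def min_def split: if_splits)
      then have "a x (y x) - \<mu> - N (w x) < 0" if "x \<in> {0..T}" for x
        using a[OF that, of "y x"] N_ge[of "w x"] \<open>A \<ge> 0\<close> by (simp add: M_def)
      then show False using DERIV_within_decreasing[OF w _ \<open>T > 0\<close>] 1 by simp
    next
      case 2
      then have "\<mu> = - M" using fixed(2) in_box(2) by (auto simp: clip_def max_def min_def split: if_splits)
      then have "a x (y x) - \<mu> - N (w x) > 0" if "x \<in> {0..T}" for x
        using a[OF that, of "y x"] N_le[of "w x"] \<open>A \<ge> 0\<close> by (simp add: M_def)
      then show False using DERIV_within_increasing[OF w _ \<open>T > 0\<close>] 2 by simp
    qed
  qed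
  have drift: "\<bar>w x - w 0\<bar> \<le> D * T" if "x \<in> {0..T}" for x
  proof -
    have "norm (w x - w 0) \<le> D * norm (x - 0)"
      using slope[of _ "y _" \<mu>] in_box(2) \<open>T > 0\<close> that
      by (intro field_differentiable_bound[OF convex_real_interval(5) w]) (auto simp: clip_id)
    also have "\<dots> \<le> D * T" using that nonneg by (intro mult_left_mono) auto
    finally show ?thesis by simp
  qed
  \<comment> \<open>Likewise a mismatch of y pushes \<open>w 0\<close> to an end of its range; then
    w keeps one sign and y moves against the assumed mismatch.\<close>
  have y_per: "y 0 = y T"
  proof (rule ccontr)
    assume "y 0 \<noteq> y T"
    then consider "y T > y 0" | "y T < y 0" by linarith
    then show False
    proof cases
      case 1
      then have "w 0 = - W" using fixed(3) in_box(3) by (auto simp: clip_def max_def min_def split: if_splits)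
      then have "w x < 0" if "x \<in> {0..T}" for x
        using drift[OF that] R(1) by (simp add: W_def)
      then have "phi r (clip R (w x)) < 0" if "x \<in> {0..T}" for x
        using that phi_strict_mono[OF r, of "clip R (w x)" 0] R(1) by (simp add: clip_less_0_iff)
      then show False using DERIV_within_decreasing[OF y _ \<open>T > 0\<close>] 1 by simp
    next
      case 2
      then have "w 0 = W" using fixed(3) in_box(3) by (auto simp: clip_def max_def min_def split: if_splits)
      then have "w x > 0" if "x \<in> {0..T}" for x
        using drift[OF that] R(1) by (simp add: W_def)
      then have "phi r (clip R (w x)) > 0" if "x \<in> {0..T}" for x
        using that phi_strict_mono[OF r, of 0 "clip R (w x)"] R(1) by (simp add: clip_gt_0_iff)
      then show False using DERIV_within_increasing[OF y _ \<open>T > 0\<close>] 2 by simp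
    qed
  qed
  obtain z where "z \<in> {0..T}" "phi r (clip R (w z)) = 0"
    using periodic_derivative_zero[OF y y_per \<open>T > 0\<close>] by blast
  then have z: "z \<in> {0..T}" "w z = 0"
    using R(1) by (auto simp: clip_def max_def min_def split: if_splits)
  have "\<bar>w x\<bar> < R" if "x \<in> {0..T}" for x
    by (rule periodic_riccati_bounds(2)[where N = N, OF \<open>T > 0\<close> w w_per z a])
      (use N_ge N_R R(1) that in auto)
  then have unclipped: "clip R (w x) = w x" if "x \<in> {0..T}" for x
    using that by (intro clip_id) (simp add: less_imp_le)
  have "log_eigen p T (\<lambda>x. a x (y x)) \<mu> y w"
    unfolding log_eigen_def using y w y_per w_per unclipped by (auto simp: N_def r_def)
  moreover have "\<sigma> * \<mu> = 0 \<or> y 0 = C \<and> \<sigma> * \<mu> > 0 \<or> y 0 = - C \<and> \<sigma> * \<mu> < 0"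
    using fixed(1) in_box(1) by (auto simp: clip_def max_def min_def split: if_splits)
  ultimately show ?thesis using that in_box(1) by blast
qed

corollary log_eigen_exists_linear:
  assumes "p > 1" "T > 0" "continuous_on {0..T} a"
  obtains \<mu> y w where "log_eigen p T a \<mu> y w"
proof -
  obtain A where A: "\<And>x. x \<in> {0..T} \<Longrightarrow> \<bar>a x\<bar> \<le> A"
    by (rule continuous_Icc_bounded[OF assms(3)]) (rule that)
  have "continuous_on ({0..T} \<times> UNIV) (\<lambda>(x, y::real). a x)"
    unfolding case_prod_unfold using assms(3) by (intro continuous_on_compose2[OF assms(3)] continuous_intros) auto
  then show ?thesis
    using log_eigen_exists[of p T 0 "\<lambda>x _. a x" A 0] assms A that by blast
qed

section \<open>Weak derivatives on an interval\<close>

lemma LINT_open_interval_eq_integral: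
  fixes g :: "real \<Rightarrow> real"
  assumes "set_integrable lborel {0<..<T} g"
  shows "g integrable_on {0..T}" "(LINT x:{0<..<T}|lborel. g x) = integral {0..T} g"
  using set_borel_integral_eq_integral[OF assms]
  by (simp_all add: integrable_on_open_interval_real integral_open_interval_real)

lemma set_integrable_open_interval_continuous:
  fixes g :: "real \<Rightarrow> real"
  assumes "continuous_on {0..T} g"
  shows "set_integrable lborel {0<..<T} g"
  by (rule set_integrable_subset[OF borel_integrable_atLeastAtMost'[OF assms]]) auto

lemma LINT_open_interval_continuous:
  fixes g :: "real \<Rightarrow> real"
  assumes "continuous_on {0..T} g"
  shows "(LINT x:{0<..<T}|lborel. g x) = integral {0..T} g"
  by (rule LINT_open_interval_eq_integral set_integrable_open_interval_continuous assms)+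

lemma set_borel_measurable_open_interval_continuous:
  fixes g :: "real \<Rightarrow> real"
  assumes "continuous_on {0..T} g"
  shows "set_borel_measurable lborel {0<..<T} g"
  unfolding set_borel_measurable_def
  using borel_measurable_continuous_on_indicator[OF _ continuous_on_subset[OF assms], of "{0<..<T}"]
  by (simp add: greaterThanLessThan_subseteq_atLeastAtMost_iff)

lemma C1_periodic_in_W1p_per:
  assumes "p > 1" "T > 0"
    and deriv: "\<And>x. x \<in> {0..T} \<Longrightarrow> (u has_real_derivative u' x) (at x within {0..T})"
    and cont: "continuous_on {0..T} u'" and per: "u 0 = u T"
  shows "in_W1p_per p T u u'"
proof -
  have contu: "continuous_on {0..T} u" by (rule DERIV_continuous_on[OF deriv])
  have "in_Lp p {0<..<T} v" if "continuous_on {0..T} v" for v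
    unfolding in_Lp_def using that \<open>p > 1\<close>
    by (intro conjI set_borel_measurable_open_interval_continuous
        set_integrable_open_interval_continuous continuous_intros) auto
  moreover have "(LINT x:{0<..<T}|lborel. u x * \<psi>' x) = - (LINT x:{0<..<T}|lborel. u' x * \<psi> x)"
    if test: "test_function {0<..<T} \<psi> \<psi>'" for \<psi> \<psi>'
  proof -
    have \<psi>: "(\<psi> has_real_derivative \<psi>' x) (at x within {0..T})" for x
      using test by (auto simp: test_function_def intro: has_field_derivative_at_within)
    then have cont\<psi>: "continuous_on {0..T} \<psi>" by (intro DERIV_continuous_on)
    have cont\<psi>': "continuous_on {0..T} \<psi>'"
      using test by (auto simp: test_function_def intro: continuous_on_subset)
    have "\<psi> 0 = 0" "\<psi> T = 0"
      using test by (auto simp: test_function_def)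
    have "((\<lambda>x. u x * \<psi>' x + u' x * \<psi> x) has_integral u T * \<psi> T - u 0 * \<psi> 0) {0..T}"
      using \<open>T > 0\<close> by (intro fundamental_theorem_of_calculus)
        (auto simp flip: has_real_derivative_iff_has_vector_derivative
          intro!: derivative_eq_intros deriv \<psi>)
    moreover have "(\<lambda>x. u x * \<psi>' x) integrable_on {0..T}" "(\<lambda>x. u' x * \<psi> x) integrable_on {0..T}"
      by (intro integrable_continuous_real continuous_intros contu cont cont\<psi> cont\<psi>')+
    ultimately have "integral {0..T} (\<lambda>x. u x * \<psi>' x) + integral {0..T} (\<lambda>x. u' x * \<psi> x) = 0"
      using \<open>\<psi> 0 = 0\<close> \<open>\<psi> T = 0\<close> by (simp add: integral_add[symmetric] integral_unique)
    then show ?thesis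
      by (simp add: LINT_open_interval_continuous continuous_on_mult contu cont cont\<psi> cont\<psi>')
  qed
  ultimately show ?thesis
    using contu cont per by (auto simp: in_W1p_per_def in_W1p_def)
qed

section \<open>Continuously differentiable approximations of an indicator function\<close>

lemma has_real_derivative_pos_part_power2:
  "((\<lambda>t::real. (max 0 t)\<^sup>2) has_real_derivative 2 * max 0 t) (at t)"
proof -
  consider "t > 0" | "t < 0" | "t = 0" by linarith
  then show ?thesis
  proof cases
    case 1
    have "((\<lambda>t. t\<^sup>2) has_real_derivative 2 * t) (at t)"
      by (auto intro!: derivative_eq_intros)
    then have "((\<lambda>t. (max 0 t)\<^sup>2) has_real_derivative 2 * t) (at t)"
      using 1 by (elim DERIV_cong_ev[THEN iffD1, rotated -1])
        (auto intro!: eventually_mono[OF eventually_nhds_in_open[of "{0<..}"]])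
    then show ?thesis using 1 by simp
  next
    case 2
    have "((\<lambda>t. 0) has_real_derivative 0) (at t)" by simp
    then have "((\<lambda>t. (max 0 t)\<^sup>2) has_real_derivative 0) (at t)"
      using 2 by (elim DERIV_cong_ev[THEN iffD1, rotated -1])
        (auto intro!: eventually_mono[OF eventually_nhds_in_open[of "{..<0}"]])
    then show ?thesis using 2 by simp
  next
    case 3
    have "(\<lambda>h. (max 0 h)\<^sup>2 / h) \<midarrow>0\<rightarrow> (max 0 0 :: real)"
    proof (rule Lim_transform_eventually)
      show "(\<lambda>h::real. max 0 h) \<midarrow>0\<rightarrow> max 0 0" by (intro tendsto_intros)
      show "\<forall>\<^sub>F h in at 0. max 0 h = (max 0 h)\<^sup>2 / (h::real)"
        unfolding eventually_at_filter by (simp add: max_def power2_eq_square)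
    qed
    then show ?thesis using 3 by (simp add: DERIV_def)
  qed
qed

text \<open>A piecewise quadratic step from 0 to 1 on [0,1]. Test functions are required to be of
  class C^1, so a piecewise linear step would not do. Its derivative \<open>tent\<close> is a
  triangle of height 2 and area 1.\<close>

definition ramp :: "real \<Rightarrow> real" where
  "ramp t = 2 * (max 0 t)\<^sup>2 - 4 * (max 0 (t - 1/2))\<^sup>2 + 2 * (max 0 (t - 1))\<^sup>2"

definition tent :: "real \<Rightarrow> real" where
  "tent t = 4 * max 0 t - 8 * max 0 (t - 1/2) + 4 * max 0 (t - 1)"

lemma has_real_derivative_ramp: "(ramp has_real_derivative tent t) (at t)"
proof -
  have D: "((\<lambda>t. (max 0 (t - c))\<^sup>2) has_real_derivative 2 * max 0 (t - c)) (at t)" for c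
    using DERIV_shift[of "\<lambda>t. (max 0 t)\<^sup>2" "2 * max 0 (t - c)" t "- c"]
      has_real_derivative_pos_part_power2[of "t - c"] by simp
  show ?thesis
    using DERIV_add[OF DERIV_diff[OF DERIV_cmult[OF D[of 0], of 2] DERIV_cmult[OF D[of "1/2"], of 4]]
        DERIV_cmult[OF D[of 1], of 2]]
    by (simp add: ramp_def[abs_def] tent_def)
qed

lemma ramp_eq_0: "t \<le> 0 \<Longrightarrow> ramp t = 0"
  by (simp add: ramp_def max_def)

lemma ramp_eq_1: "t \<ge> 1 \<Longrightarrow> ramp t = 1"
  by (simp add: ramp_def max_def power2_eq_square algebra_simps)

lemma tent_nonneg: "tent t \<ge> 0"
  by (simp add: tent_def max_def)

lemma tent_eq_0: "t \<le> 0 \<or> t \<ge> 1 \<Longrightarrow> tent t = 0"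
  by (auto simp: tent_def max_def)

lemma ramp_bounds: "ramp t \<in> {0..1}"
proof -
  have mono: "ramp s \<le> ramp t" if "s \<le> t" for s t
    using that has_real_derivative_ramp tent_nonneg by (auto intro: DERIV_nonneg_imp_nondecreasing)
  show ?thesis
    using mono[of "min 0 t" t] mono[of t "max 1 t"] by (simp add: ramp_eq_0 ramp_eq_1)
qed

lemma continuous_on_tent [continuous_intros]:
  "continuous_on S g \<Longrightarrow> continuous_on S (\<lambda>x. tent (g x))"
  unfolding tent_def by (intro continuous_intros)

lemma has_real_derivative_scaled_ramp:
  assumes "\<delta> > 0"
  shows "((\<lambda>x. ramp ((x - c) / \<delta>)) has_real_derivative tent ((x - c) / \<delta>) / \<delta>) (at x)"
proof -
  have "((\<lambda>x. (x - c) / \<delta>) has_real_derivative 1 / \<delta>) (at x)"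
    using assms by (auto intro!: derivative_eq_intros)
  from DERIV_chain2[OF has_real_derivative_ramp this] show ?thesis by simp
qed

text \<open>The scaled tent is a probability density on \<open>{c..c + \<delta>}\<close>, so the
  integral is a weighted mean of values of u close to \<open>u0\<close>.\<close>

lemma integral_tent_approximates:
  fixes u :: "real \<Rightarrow> real"
  assumes "\<delta> > 0" "0 \<le> c" "c + \<delta> \<le> T" and cont: "continuous_on {0..T} u"
    and close: "\<And>x. x \<in> {c..c + \<delta>} \<Longrightarrow> \<bar>u x - u0\<bar> \<le> \<epsilon>"
  shows "\<bar>integral {0..T} (\<lambda>x. u x * (tent ((x - c) / \<delta>) / \<delta>)) - u0\<bar> \<le> \<epsilon>"
proof -
  let ?t = "\<lambda>x. tent ((x - c) / \<delta>) / \<delta>"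
  have t0: "?t x = 0" if "x \<notin> {c..c + \<delta>}" for x
    using that \<open>\<delta> > 0\<close> tent_eq_0[of "(x - c) / \<delta>"] by (auto simp: field_simps)
  have "(?t has_integral ramp ((T - c) / \<delta>) - ramp ((0 - c) / \<delta>)) {0..T}"
    using assms has_real_derivative_scaled_ramp[OF \<open>\<delta> > 0\<close>]
    by (intro fundamental_theorem_of_calculus)
      (auto simp flip: has_real_derivative_iff_has_vector_derivative
        intro: has_field_derivative_at_within)
  moreover have "ramp ((T - c) / \<delta>) = 1" "ramp ((0 - c) / \<delta>) = 0"
    using assms by (auto intro!: ramp_eq_1 ramp_eq_0 simp: field_simps)
  ultimately have t1: "(?t has_integral 1) {0..T}" by simp
  have cont_t: "continuous_on {0..T} ?t" using \<open>\<delta> > 0\<close> by (intro continuous_intros) auto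
  have ut: "(\<lambda>x. u x * ?t x) integrable_on {0..T}"
    by (intro integrable_continuous_real continuous_on_mult cont cont_t)
  have diff: "((\<lambda>x. u x * ?t x - u0 * ?t x) has_integral integral {0..T} (\<lambda>x. u x * ?t x) - u0 * 1) {0..T}"
    by (intro has_integral_diff integrable_integral ut has_integral_mult_right t1)
  have "norm (integral {0..T} (\<lambda>x. u x * ?t x - u0 * ?t x)) \<le> integral {0..T} (\<lambda>x. \<epsilon> * ?t x)"
  proof (rule integral_norm_bound_integral)
    show "(\<lambda>x. \<epsilon> * ?t x) integrable_on {0..T}"
      using has_integral_mult_right[OF t1] by blast
    show "norm (u x * ?t x - u0 * ?t x) \<le> \<epsilon> * ?t x" if "x \<in> {0..T}" for x
    proof (cases "x \<in> {c..c + \<delta>}")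
      case True
      have "u x * ?t x - u0 * ?t x = (u x - u0) * ?t x" by (rule left_diff_distrib[symmetric])
      then have "norm (u x * ?t x - u0 * ?t x) = \<bar>u x - u0\<bar> * ?t x"
        using tent_nonneg[of "(x - c) / \<delta>"] \<open>\<delta> > 0\<close> by (simp add: abs_mult)
      then show ?thesis using close[OF True] tent_nonneg[of "(x - c) / \<delta>"] \<open>\<delta> > 0\<close>
        by (simp only:) (intro mult_right_mono, auto)
    next
      case False
      from t0[OF False] show ?thesis by (simp only:) simp
    qed
  qed (use diff in blast)
  moreover have "integral {0..T} (\<lambda>x. \<epsilon> * ?t x) = \<epsilon>"
    using integral_unique[OF has_integral_mult_right[OF t1, of \<epsilon>]] by simp
  ultimately show ?thesis using integral_unique[OF diff] by simp
qed

lemma in_Lp_imp_set_integrable: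
  assumes "p > 1" "in_Lp p {0<..<T} v"
  shows "set_integrable lborel {0<..<T} v"
proof (rule set_integrable_bound)
  show "set_integrable lborel {0<..<T} (\<lambda>x. 1 + \<bar>v x\<bar> powr p)"
    using assms set_integral_add(1)[OF set_integrable_open_interval_continuous[OF continuous_on_const]]
    by (simp add: in_Lp_def)
  show "set_borel_measurable lborel {0<..<T} v" using assms by (simp add: in_Lp_def)
  have "\<bar>t\<bar> \<le> 1 + \<bar>t\<bar> powr p" for t :: real
    using powr_mono[of 1 p "\<bar>t\<bar>"] assms by (cases "\<bar>t\<bar> \<le> 1") (auto intro: order_trans)
  then show "AE x in lborel. x \<in> {0<..<T} \<longrightarrow> norm (v x) \<le> norm (1 + \<bar>v x\<bar> powr p)"
    by (intro AE_I2) (auto intro: order_trans[OF _ abs_ge_self])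
qed

text \<open>The trapezoidal test functions converge to the indicator of \<open>[\<alpha>, \<beta>]\<close>.\<close>
lemma weak_derivative_increment_interior:
  assumes "p > 1" "in_W1p p {0<..<T} u u'" and cont: "continuous_on {0..T} u"
    and ab: "0 < \<alpha>" "\<alpha> \<le> \<beta>" "\<beta> < T"
  shows "u \<beta> - u \<alpha> = integral {\<alpha>..\<beta>} u'"
proof -
  \<comment> \<open>Denominators of at least 2 keep
    \<open>{\<alpha> - \<delta> n..\<beta> + \<delta> n}\<close> inside the open interval.\<close>
  define \<delta> where "\<delta> n = min \<alpha> (T - \<beta>) / real (Suc (Suc n))" for n
  have \<delta>: "\<delta> n > 0" "\<delta> n < \<alpha>" "\<beta> + \<delta> n < T" for n
  proof -
    show pos: "\<delta> n > 0" using ab by (simp add: \<delta>_def)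
    define k where "k = min \<alpha> (T - \<beta>)"
    have k: "k \<le> \<alpha>" "k \<le> T - \<beta>" by (simp_all add: k_def)
    have "\<delta> n \<le> k / 2" unfolding \<delta>_def k_def
      using ab by (intro divide_left_mono) auto
    then show "\<delta> n < \<alpha>" "\<beta> + \<delta> n < T"
      using pos k by simp_all
  qed
  have \<delta>_lim: "\<delta> \<longlonglongrightarrow> 0" unfolding \<delta>_def
    using LIMSEQ_Suc[OF LIMSEQ_Suc[OF lim_const_over_n]] .
  \<comment> \<open>The function rises just before \<alpha>, equals 1 on
    \<open>{\<alpha>..\<beta>}\<close> and falls just after \<beta>. Its derivative is a difference
    of two densities, so integrating u against it tends to
    \<open>u \<alpha> - u \<beta>\<close>.\<close>
  define \<psi> where "\<psi> n x = ramp ((x - (\<alpha> - \<delta> n)) / \<delta> n) - ramp ((x - \<beta>) / \<delta> n)" for n x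
  define \<psi>' where "\<psi>' n x = tent ((x - (\<alpha> - \<delta> n)) / \<delta> n) / \<delta> n - tent ((x - \<beta>) / \<delta> n) / \<delta> n" for n x
  have \<psi>_deriv: "(\<psi> n has_real_derivative \<psi>' n x) (at x)" for n x
    unfolding \<psi>_def \<psi>'_def by (intro DERIV_diff has_real_derivative_scaled_ramp \<delta>)
  have \<psi>_outside: "\<psi> n x = 0" if "x \<notin> {\<alpha> - \<delta> n..\<beta> + \<delta> n}" for n x
  proof (cases "x < \<alpha> - \<delta> n")
    case True
    then show ?thesis using \<delta>[of n] ab by (auto simp: \<psi>_def ramp_eq_0 divide_le_0_iff)
  next
    case False
    then show ?thesis using that \<delta>[of n] ab by (auto simp: \<psi>_def ramp_eq_1 field_simps)
  qed
  have \<psi>_bound: "\<bar>\<psi> n x\<bar> \<le> 1" for n x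
    using ramp_bounds[of "(x - (\<alpha> - \<delta> n)) / \<delta> n"] ramp_bounds[of "(x - \<beta>) / \<delta> n"]
    by (auto simp: \<psi>_def abs_le_iff)
  have cont_\<psi>: "continuous_on S (\<psi> n)" for S n
    using \<psi>_deriv by (meson DERIV_continuous_on has_field_derivative_at_within)
  have test: "test_function {0<..<T} (\<psi> n) (\<psi>' n)" for n
    unfolding test_function_def
  proof (intro conjI allI exI[of _ "{\<alpha> - \<delta> n..\<beta> + \<delta> n}"] impI)
    show "continuous_on UNIV (\<psi>' n)"
      unfolding \<psi>'_def using \<delta>(1)[of n] by (intro continuous_intros) auto
    show "{\<alpha> - \<delta> n..\<beta> + \<delta> n} \<subseteq> {0<..<T}" using \<delta>[of n] by auto
  qed (auto simp: \<psi>_deriv \<psi>_outside)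
  have int_u': "set_integrable lborel {0<..<T} u'"
    using assms by (intro in_Lp_imp_set_integrable) (auto simp: in_W1p_def)
  have int_prod: "set_integrable lborel {0<..<T} (\<lambda>x. u' x * \<psi> n x)" for n
  proof (rule set_integrable_bound[OF int_u'])
    have "(\<lambda>x. indicator {0<..<T} x *\<^sub>R u' x) \<in> borel_measurable lborel"
      using int_u' by (simp add: set_integrable_def borel_measurable_integrable)
    moreover have "\<psi> n \<in> borel_measurable lborel"
      using borel_measurable_continuous_onI[OF cont_\<psi>] by simp
    ultimately have "(\<lambda>x. (indicator {0<..<T} x *\<^sub>R u' x) * \<psi> n x) \<in> borel_measurable lborel"
      by (rule borel_measurable_times)
    then show "set_borel_measurable lborel {0<..<T} (\<lambda>x. u' x * \<psi> n x)"
      by (simp add: set_borel_measurable_def mult.assoc)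
    show "AE x in lborel. x \<in> {0<..<T} \<longrightarrow> norm (u' x * \<psi> n x) \<le> norm (u' x)"
      using \<psi>_bound by (intro AE_I2) (auto simp: abs_mult mult_left_le)
  qed
  have "(\<lambda>n. integral {0..T} (\<lambda>x. u' x * \<psi> n x)) \<longlonglongrightarrow> integral {0..T} (\<lambda>x. if x \<in> {\<alpha>..\<beta>} then u' x else 0)"
  proof (rule dominated_convergence(2)[where h = "\<lambda>x. \<bar>u' x\<bar>"])
    show "(\<lambda>x. u' x * \<psi> n x) integrable_on {0..T}" for n
      by (rule LINT_open_interval_eq_integral[OF int_prod])
    have "set_integrable lborel {0<..<T} (\<lambda>x. \<bar>u' x\<bar>)" using int_u' by (rule set_integrable_abs)
    then show "(\<lambda>x. \<bar>u' x\<bar>) integrable_on {0..T}" by (rule LINT_open_interval_eq_integral)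
    show "norm (u' x * \<psi> n x) \<le> \<bar>u' x\<bar>" for n x
      using \<psi>_bound by (auto simp: abs_mult mult_left_le)
    show "(\<lambda>n. u' x * \<psi> n x) \<longlonglongrightarrow> (if x \<in> {\<alpha>..\<beta>} then u' x else 0)" for x
    proof (cases "x \<in> {\<alpha>..\<beta>}")
      case True
      have "\<psi> n x = 1" for n
        using True \<delta>[of n] by (simp add: \<psi>_def ramp_eq_1 ramp_eq_0 divide_le_0_iff)
      then show ?thesis using True by simp
    next
      case False
      define d where "d = (if x < \<alpha> then \<alpha> - x else x - \<beta>)"
      have "d > 0" using False by (auto simp: d_def)
      have "\<forall>\<^sub>F n in sequentially. \<delta> n < d"
        using \<delta>_lim \<open>d > 0\<close> by (rule order_tendstoD)
      then have "\<forall>\<^sub>F n in sequentially. u' x * \<psi> n x = 0"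
        by eventually_elim (use False in \<open>auto simp: d_def intro!: \<psi>_outside split: if_splits\<close>)
      then show ?thesis unfolding if_not_P[OF False] by (rule tendsto_eventually)
    qed
  qed
  also have "integral {0..T} (\<lambda>x. if x \<in> {\<alpha>..\<beta>} then u' x else 0) = integral {\<alpha>..\<beta>} u'"
    using ab by (intro integral_restrict_Int[of "{0..T}" "{\<alpha>..\<beta>}" u', THEN trans]) (simp add: Int_absorb1 Int_absorb2)
  finally have lim_u': "(\<lambda>n. integral {0..T} (\<lambda>x. u' x * \<psi> n x)) \<longlonglongrightarrow> integral {\<alpha>..\<beta>} u'" .
  have ut_int: "(\<lambda>x. u x * (tent ((x - c) / \<delta> n) / \<delta> n)) integrable_on {0..T}" for c n
    using \<delta>(1)[of n] by (intro integrable_continuous_real continuous_intros cont) auto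
  have u\<psi>': "integral {0..T} (\<lambda>x. u x * \<psi>' n x) =
      integral {0..T} (\<lambda>x. u x * (tent ((x - (\<alpha> - \<delta> n)) / \<delta> n) / \<delta> n)) -
      integral {0..T} (\<lambda>x. u x * (tent ((x - \<beta>) / \<delta> n) / \<delta> n))" for n
    unfolding \<psi>'_def right_diff_distrib by (rule integral_diff[OF ut_int ut_int])
  have weak: "integral {0..T} (\<lambda>x. u x * \<psi>' n x) = - integral {0..T} (\<lambda>x. u' x * \<psi> n x)" for n
  proof -
    have "(LINT x:{0<..<T}|lborel. u x * \<psi>' n x) = - (LINT x:{0<..<T}|lborel. u' x * \<psi> n x)"
      using assms(2) test by (auto simp: in_W1p_def)
    moreover have "continuous_on {0..T} (\<psi>' n)"
      using test by (auto simp: test_function_def intro: continuous_on_subset)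
    ultimately show ?thesis
      using LINT_open_interval_eq_integral(2)[OF int_prod]
      by (simp add: LINT_open_interval_continuous continuous_on_mult cont)
  qed
  have tent_lim: "(\<lambda>n. integral {0..T} (\<lambda>x. u x * (tent ((x - c n) / \<delta> n) / \<delta> n))) \<longlonglongrightarrow> u \<gamma>"
    if c: "\<And>n. \<gamma> - \<delta> n \<le> c n" "\<And>n. c n \<le> \<gamma>" "\<And>n. 0 \<le> c n" "\<And>n. c n + \<delta> n \<le> T"
      and \<gamma>: "\<gamma> \<in> {0..T}" for c \<gamma>
    unfolding LIMSEQ_iff
  proof (intro allI impI)
    fix \<epsilon> :: real assume "\<epsilon> > 0"
    then obtain d where "d > 0" and d: "\<And>x. x \<in> {0..T} \<Longrightarrow> \<bar>x - \<gamma>\<bar> < d \<Longrightarrow> \<bar>u x - u \<gamma>\<bar> < \<epsilon> / 2"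
      using cont \<gamma> unfolding continuous_on_iff dist_real_def by (metis half_gt_zero)
    have "\<forall>\<^sub>F n in sequentially. \<delta> n < d"
      using \<delta>_lim \<open>d > 0\<close> by (rule order_tendstoD)
    then obtain N where N: "\<And>n. n \<ge> N \<Longrightarrow> \<delta> n < d" by (auto simp: eventually_sequentially)
    have "\<bar>integral {0..T} (\<lambda>x. u x * (tent ((x - c n) / \<delta> n) / \<delta> n)) - u \<gamma>\<bar> \<le> \<epsilon> / 2" if "n \<ge> N" for n
    proof (rule integral_tent_approximates)
      fix x assume "x \<in> {c n..c n + \<delta> n}"
      then show "\<bar>u x - u \<gamma>\<bar> \<le> \<epsilon> / 2"
        using N[OF that] c(1-4)[of n] \<gamma> by (intro less_imp_le d) auto
    qed (use \<delta> c cont in auto)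
    then show "\<exists>N. \<forall>n\<ge>N. norm (integral {0..T} (\<lambda>x. u x * (tent ((x - c n) / \<delta> n) / \<delta> n)) - u \<gamma>) < \<epsilon>"
      using \<open>\<epsilon> > 0\<close> by (intro exI[of _ N]) (fastforce intro: order.strict_trans1)
  qed
  have "(\<lambda>n. integral {0..T} (\<lambda>x. u x * \<psi>' n x)) \<longlonglongrightarrow> u \<alpha> - u \<beta>"
    unfolding u\<psi>' using ab \<delta> by (intro tendsto_diff tent_lim) (auto simp: less_imp_le)
  then have "(\<lambda>n. - integral {0..T} (\<lambda>x. u' x * \<psi> n x)) \<longlonglongrightarrow> u \<alpha> - u \<beta>"
    by (simp add: weak)
  moreover have "(\<lambda>n. - integral {0..T} (\<lambda>x. u' x * \<psi> n x)) \<longlonglongrightarrow> - integral {\<alpha>..\<beta>} u'"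
    by (intro tendsto_minus lim_u')
  ultimately show ?thesis using LIMSEQ_unique by fastforce
qed

text \<open>By the interior case, u minus the indefinite integral of u' is constant on the open
  interval, hence by continuity on the closed one.\<close>

lemma weak_derivative_increment:
  assumes "p > 1" and W: "in_W1p p {0<..<T} u u'" and cont: "continuous_on {0..T} u"
    and "0 \<le> \<alpha>" "\<alpha> \<le> \<beta>" "\<beta> \<le> T"
  shows "u \<beta> - u \<alpha> = integral {\<alpha>..\<beta>} u'"
proof (cases "T > 0")
  case True
  have int: "u' integrable_on {0..T}"
    using assms by (intro LINT_open_interval_eq_integral in_Lp_imp_set_integrable) (auto simp: in_W1p_def)
  define I where "I x = integral {0..x} u'" for x
  have cont_I: "continuous_on {0..T} I"
    unfolding I_def by (rule indefinite_integral_continuous_1[OF int])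
  have I_diff: "I b - I a = integral {a..b} u'" if "0 \<le> a" "a \<le> b" "b \<le> T" for a b
    using Henstock_Kurzweil_Integration.integral_combine[of 0 a b u'] that
      integrable_subinterval_real[OF int, of 0 b] by (simp add: I_def)
  define h where "h x = (u x - I x) - (u (T/2) - I (T/2))" for x
  have "continuous_on {0..T} h" unfolding h_def by (intro continuous_intros cont cont_I)
  moreover have "h x = 0" if "x \<in> {0<..<T}" for x
  proof (cases "x \<le> T/2")
    case True
    then show ?thesis
      using weak_derivative_increment_interior[OF \<open>p > 1\<close> W cont, of x "T/2"] I_diff[of x "T/2"] that
      by (simp add: h_def)
  next
    case False
    then show ?thesis
      using weak_derivative_increment_interior[OF \<open>p > 1\<close> W cont, of "T/2" x] I_diff[of "T/2" x] that
      by (simp add: h_def)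
  qed
  moreover have "closure {0<..<T} = {0..T}" using True by simp
  ultimately have "h x = 0" if "x \<in> {0..T}" for x
    using continuous_constant_on_closure[of "{0<..<T}" h 0 x] that by metis
  then have "h \<alpha> = h \<beta>" using assms by simp
  then show ?thesis using I_diff[of \<alpha> \<beta>] assms by (simp add: h_def)
next
  case False
  then have "\<alpha> = \<beta>" using assms by linarith
  then show ?thesis by simp
qed

text \<open>The tangent to |t|^p at the mean slope s lies below the graph; in its integral the
  linear term cancels.\<close>

lemma weak_derivative_jensen:
  assumes "p > 1" and W: "in_W1p p {0<..<T} u u'" and cont: "continuous_on {0..T} u"
    and "0 \<le> \<alpha>" "\<alpha> < \<beta>" "\<beta> \<le> T"
  shows "(\<beta> - \<alpha>) * \<bar>(u \<beta> - u \<alpha>) / (\<beta> - \<alpha>)\<bar> powr p \<le> integral {\<alpha>..\<beta>} (\<lambda>x. \<bar>u' x\<bar> powr p)"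
proof -
  define s where "s = (u \<beta> - u \<alpha>) / (\<beta> - \<alpha>)"
  have sub: "g integrable_on {\<alpha>..\<beta>}" if "set_integrable lborel {0<..<T} g" for g :: "real \<Rightarrow> real"
    using integrable_subinterval_real[OF LINT_open_interval_eq_integral(1)[OF that]] assms by simp
  have int: "u' integrable_on {\<alpha>..\<beta>}" "(\<lambda>x. \<bar>u' x\<bar> powr p) integrable_on {\<alpha>..\<beta>}"
    using W \<open>p > 1\<close> by (auto intro!: sub in_Lp_imp_set_integrable simp: in_W1p_def in_Lp_def)
  have const: "((\<lambda>x. c) has_integral (\<beta> - \<alpha>) * c) {\<alpha>..\<beta>}" for c :: real
    using has_integral_const_real[of c \<alpha> \<beta>] \<open>\<alpha> < \<beta>\<close> by simp
  have "integral {\<alpha>..\<beta>} u' = s * (\<beta> - \<alpha>)"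
    using weak_derivative_increment[OF assms(1-4)] assms by (simp add: s_def)
  then have "((\<lambda>x. \<bar>s\<bar> powr p + p * phi p s * (u' x - s)) has_integral
      (\<beta> - \<alpha>) * \<bar>s\<bar> powr p + p * phi p s * (s * (\<beta> - \<alpha>) - (\<beta> - \<alpha>) * s)) {\<alpha>..\<beta>}"
    using integrable_integral[OF int(1)] const
    by (intro has_integral_add has_integral_mult_right has_integral_diff) auto
  moreover have "\<bar>s\<bar> powr p + p * phi p s * (u' x - s) \<le> \<bar>u' x\<bar> powr p" for x
    by (rule abs_powr_above_tangent[OF \<open>p > 1\<close>])
  ultimately have "(\<beta> - \<alpha>) * \<bar>s\<bar> powr p + p * phi p s * (s * (\<beta> - \<alpha>) - (\<beta> - \<alpha>) * s)
      \<le> integral {\<alpha>..\<beta>} (\<lambda>x. \<bar>u' x\<bar> powr p)"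
    by (rule has_integral_le[OF _ integrable_integral[OF int(2)]])
  then show ?thesis by (simp add: s_def)
qed

section \<open>Picone's inequality\<close>

text \<open>Summing over an even subdivision gives \<open>G T - G 0 \<ge> - \<epsilon> * T\<close>.
  This suits a G built from a weakly differentiable function, for which a pointwise derivative is
  not at hand.\<close>

lemma le_of_small_increments:
  fixes G :: "real \<Rightarrow> real"
  assumes "T > 0"
    and incr: "\<And>\<epsilon>. \<epsilon> > 0 \<Longrightarrow> \<exists>\<delta>>0. \<forall>\<alpha> \<beta>. 0 \<le> \<alpha> \<longrightarrow> \<alpha> < \<beta> \<longrightarrow> \<beta> \<le> T \<longrightarrow> \<beta> - \<alpha> < \<delta> \<longrightarrow>
      - \<epsilon> * (\<beta> - \<alpha>) \<le> G \<beta> - G \<alpha>"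
  shows "G 0 \<le> G T"
proof (rule ccontr)
  assume "\<not> G 0 \<le> G T"
  define \<epsilon> where "\<epsilon> = (G 0 - G T) / (2 * T)"
  have "\<epsilon> > 0" using \<open>\<not> G 0 \<le> G T\<close> \<open>T > 0\<close> by (simp add: \<epsilon>_def)
  from incr[OF this] obtain \<delta> where "\<delta> > 0" and \<delta>: "\<And>\<alpha> \<beta>. \<lbrakk>0 \<le> \<alpha>; \<alpha> < \<beta>; \<beta> \<le> T; \<beta> - \<alpha> < \<delta>\<rbrakk> \<Longrightarrow>
      - \<epsilon> * (\<beta> - \<alpha>) \<le> G \<beta> - G \<alpha>" by blast
  obtain n where n: "T / real (Suc n) < \<delta>"
    using order_tendstoD(2)[OF LIMSEQ_Suc[OF lim_const_over_n[of T]] \<open>\<delta> > 0\<close>]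
    by (auto simp: eventually_sequentially)
  define h where "h = T / real (Suc n)"
  have h: "h > 0" "real (Suc n) * h = T" using \<open>T > 0\<close> by (simp_all add: h_def)
  have "- \<epsilon> * (real i * h) \<le> G (real i * h) - G 0" if "i \<le> Suc n" for i
    using that
  proof (induction i)
    case (Suc i)
    have "real (Suc i) * h \<le> real (Suc n) * h" using Suc h(1) by (intro mult_right_mono) auto
    then have "- \<epsilon> * (real (Suc i) * h - real i * h) \<le> G (real (Suc i) * h) - G (real i * h)"
      unfolding h(2) using h(1) n[folded h_def] by (intro \<delta>) (auto simp: algebra_simps)
    moreover have "- \<epsilon> * (real i * h) \<le> G (real i * h) - G 0" using Suc by simp
    ultimately show ?case by (simp add: algebra_simps)
  qed simp
  from this[of "Suc n"] have "- (\<epsilon> * T) \<le> G T - G 0" unfolding h(2) by simp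
  moreover have "\<epsilon> * T * 2 = G 0 - G T" using \<open>T > 0\<close> by (simp add: \<epsilon>_def)
  ultimately show False using \<open>\<not> G 0 \<le> G T\<close> by linarith
qed

text \<open>Along an affine l the product rule applies to |l|^p w, and inserting the Riccati
  equation leaves exactly the terms that Young's inequality bounds by |s|^p + b |l|^p.\<close>

lemma riccati_affine:
  assumes "p > 1" "\<alpha> < \<beta>"
    and w: "\<And>x. x \<in> {\<alpha>..\<beta>} \<Longrightarrow>
      (w has_real_derivative b x - (p - 1) * \<bar>w x\<bar> powr (p / (p - 1))) (at x within {\<alpha>..\<beta>})"
    and contb: "continuous_on {\<alpha>..\<beta>} b"
  shows "\<bar>c + s * (\<beta> - \<alpha>)\<bar> powr p * w \<beta> - \<bar>c\<bar> powr p * w \<alpha>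
    \<le> (\<beta> - \<alpha>) * \<bar>s\<bar> powr p + integral {\<alpha>..\<beta>} (\<lambda>x. b x * \<bar>c + s * (x - \<alpha>)\<bar> powr p)"
proof -
  define l where "l x = c + s * (x - \<alpha>)" for x
  let ?w' = "\<lambda>x. b x - (p - 1) * \<bar>w x\<bar> powr (p / (p - 1))"
  have l: "(l has_real_derivative s) (at x within {\<alpha>..\<beta>})" for x
    unfolding l_def[abs_def] by (auto intro!: derivative_eq_intros)
  have lp: "((\<lambda>x. \<bar>l x\<bar> powr p) has_real_derivative p * phi p (l x) * s) (at x within {\<alpha>..\<beta>})" for x
    by (rule DERIV_chain2[OF has_real_derivative_abs_powr[OF \<open>p > 1\<close>] l])
  have "((\<lambda>x. p * phi p (l x) * s * w x + ?w' x * \<bar>l x\<bar> powr p) has_integral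
      \<bar>l \<beta>\<bar> powr p * w \<beta> - \<bar>l \<alpha>\<bar> powr p * w \<alpha>) {\<alpha>..\<beta>}"
    using \<open>\<alpha> < \<beta>\<close> by (intro fundamental_theorem_of_calculus)
      (auto simp flip: has_real_derivative_iff_has_vector_derivative intro!: DERIV_mult lp w)
  moreover have "((\<lambda>x. \<bar>s\<bar> powr p + b x * \<bar>l x\<bar> powr p) has_integral
      (\<beta> - \<alpha>) * \<bar>s\<bar> powr p + integral {\<alpha>..\<beta>} (\<lambda>x. b x * \<bar>l x\<bar> powr p)) {\<alpha>..\<beta>}"
  proof (rule has_integral_add)
    show "((\<lambda>x. \<bar>s\<bar> powr p) has_integral (\<beta> - \<alpha>) * \<bar>s\<bar> powr p) {\<alpha>..\<beta>}"
      using has_integral_const_real[of "\<bar>s\<bar> powr p" \<alpha> \<beta>] \<open>\<alpha> < \<beta>\<close> by simp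
    show "((\<lambda>x. b x * \<bar>l x\<bar> powr p) has_integral integral {\<alpha>..\<beta>} (\<lambda>x. b x * \<bar>l x\<bar> powr p)) {\<alpha>..\<beta>}"
      using \<open>p > 1\<close> unfolding l_def
      by (intro integrable_integral integrable_continuous_real continuous_intros contb) auto
  qed
  moreover have "p * phi p (l x) * s * w x + ?w' x * \<bar>l x\<bar> powr p \<le> \<bar>s\<bar> powr p + b x * \<bar>l x\<bar> powr p" for x
    using young_phi[OF \<open>p > 1\<close>, of "l x" s "w x"] by (simp add: algebra_simps)
  ultimately have "\<bar>l \<beta>\<bar> powr p * w \<beta> - \<bar>l \<alpha>\<bar> powr p * w \<alpha>
      \<le> (\<beta> - \<alpha>) * \<bar>s\<bar> powr p + integral {\<alpha>..\<beta>} (\<lambda>x. b x * \<bar>l x\<bar> powr p)"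
    by (rule has_integral_le)
  then show ?thesis by (simp add: l_def)
qed

text \<open>A value between u \<alpha> and u \<beta> is taken by u itself at some \<xi> in the same
  short interval, so uniform continuity of |u|^p suffices.\<close>

lemma affine_interpolant_close:
  fixes u :: "real \<Rightarrow> real"
  assumes "p > 0" "continuous_on {0..T} u" "\<eta> > 0"
  obtains \<delta> where "\<delta> > 0"
    and "\<And>\<alpha> \<beta> x. \<lbrakk>0 \<le> \<alpha>; \<alpha> < \<beta>; \<beta> \<le> T; \<beta> - \<alpha> < \<delta>; x \<in> {\<alpha>..\<beta>}\<rbrakk> \<Longrightarrow>
      \<bar>\<bar>u \<alpha> + (u \<beta> - u \<alpha>) / (\<beta> - \<alpha>) * (x - \<alpha>)\<bar> powr p - \<bar>u x\<bar> powr p\<bar> \<le> \<eta>"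
proof -
  have "uniformly_continuous_on {0..T} (\<lambda>x. \<bar>u x\<bar> powr p)"
    using assms by (intro compact_uniformly_continuous continuous_intros) auto
  then obtain \<delta> where "\<delta> > 0" and \<delta>: "\<And>x x'. \<lbrakk>x \<in> {0..T}; x' \<in> {0..T}; \<bar>x' - x\<bar> < \<delta>\<rbrakk>
      \<Longrightarrow> \<bar>\<bar>u x'\<bar> powr p - \<bar>u x\<bar> powr p\<bar> < \<eta>"
    using \<open>\<eta> > 0\<close> unfolding uniformly_continuous_on_def dist_real_def by metis
  have "\<bar>\<bar>u \<alpha> + (u \<beta> - u \<alpha>) / (\<beta> - \<alpha>) * (x - \<alpha>)\<bar> powr p - \<bar>u x\<bar> powr p\<bar> \<le> \<eta>"
    if ab: "0 \<le> \<alpha>" "\<alpha> < \<beta>" "\<beta> \<le> T" "\<beta> - \<alpha> < \<delta>" and x: "x \<in> {\<alpha>..\<beta>}" for \<alpha> \<beta> x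
  proof -
    define t where "t = (x - \<alpha>) / (\<beta> - \<alpha>)"
    have t: "0 \<le> t" "t \<le> 1" using ab x by (simp_all add: t_def)
    have eq: "u \<alpha> + (u \<beta> - u \<alpha>) / (\<beta> - \<alpha>) * (x - \<alpha>) = (1 - t) * u \<alpha> + t * u \<beta>"
    proof -
      have "(u \<beta> - u \<alpha>) / (\<beta> - \<alpha>) * (x - \<alpha>) = (u \<beta> - u \<alpha>) * t" by (simp add: t_def)
      then show ?thesis by (simp add: algebra_simps)
    qed
    have "is_interval (u ` {\<alpha>..\<beta>})"
      unfolding is_interval_connected_1 using ab
      by (intro connected_continuous_image continuous_on_subset[OF assms(2)]) auto
    then have "convex (u ` {\<alpha>..\<beta>})" by (rule is_interval_convex)
    then have "(1 - t) *\<^sub>R u \<alpha> + t *\<^sub>R u \<beta> \<in> u ` {\<alpha>..\<beta>}"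
      using ab t by (intro convexD) auto
    then obtain \<xi> where \<xi>: "\<xi> \<in> {\<alpha>..\<beta>}" "u \<xi> = (1 - t) * u \<alpha> + t * u \<beta>" by auto
    have "\<bar>\<bar>u \<xi>\<bar> powr p - \<bar>u x\<bar> powr p\<bar> < \<eta>"
      using \<xi>(1) ab x by (intro \<delta>) auto
    then show ?thesis unfolding eq \<xi>(2) by simp
  qed
  then show ?thesis using that \<open>\<delta> > 0\<close> by blast
qed

lemma in_W1p_per_integrable:
  assumes "p > 1" "in_W1p_per p T u u'" "continuous_on {0..T} a"
  shows "set_integrable lborel {0<..<T} (\<lambda>x. \<bar>u' x\<bar> powr p)"
    and "set_integrable lborel {0<..<T} (\<lambda>x. a x * \<bar>u x\<bar> powr p)"
    and "continuous_on {0..T} (\<lambda>x. a x * \<bar>u x\<bar> powr p)"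
proof -
  show "set_integrable lborel {0<..<T} (\<lambda>x. \<bar>u' x\<bar> powr p)"
    using assms by (auto simp: in_W1p_per_def in_W1p_def in_Lp_def)
  show "continuous_on {0..T} (\<lambda>x. a x * \<bar>u x\<bar> powr p)"
    using assms by (intro continuous_intros) (auto simp: in_W1p_per_def)
  then show "set_integrable lborel {0<..<T} (\<lambda>x. a x * \<bar>u x\<bar> powr p)"
    by (rule set_integrable_open_interval_continuous)
qed

lemma energy_eq_integral:
  assumes "p > 1" "in_W1p_per p T u u'" "continuous_on {0..T} a"
  shows "energy p T a u u' = integral {0..T} (\<lambda>x. \<bar>u' x\<bar> powr p) + integral {0..T} (\<lambda>x. a x * \<bar>u x\<bar> powr p)"
  unfolding energy_def using in_W1p_per_integrable[OF assms]
  by (simp add: set_integral_add LINT_open_interval_eq_integral)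

lemma energy_diff_weight:
  assumes "p > 1" "in_W1p_per p T u u'" "continuous_on {0..T} q" "continuous_on {0..T} m"
  shows "energy p T (\<lambda>x. q x - s * m x) u u' =
    energy p T q u u' - s * (LINT x:{0<..<T}|lborel. m x * \<bar>u x\<bar> powr p)"
proof -
  have cont: "continuous_on {0..T} (\<lambda>x. q x - s * m x)" using assms by (intro continuous_intros)
  have q: "(\<lambda>x. q x * \<bar>u x\<bar> powr p) integrable_on {0..T}"
    by (rule integrable_continuous_real[OF in_W1p_per_integrable(3)[OF assms(1-3)]])
  have s: "(\<lambda>x. s * (m x * \<bar>u x\<bar> powr p)) integrable_on {0..T}"
    by (intro integrable_continuous_real continuous_on_mult_left in_W1p_per_integrable(3)[OF assms(1,2,4)])
  have "integral {0..T} (\<lambda>x. (q x - s * m x) * \<bar>u x\<bar> powr p) =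
      integral {0..T} (\<lambda>x. q x * \<bar>u x\<bar> powr p - s * (m x * \<bar>u x\<bar> powr p))"
    by (simp add: algebra_simps)
  also have "\<dots> = integral {0..T} (\<lambda>x. q x * \<bar>u x\<bar> powr p) - s * integral {0..T} (\<lambda>x. m x * \<bar>u x\<bar> powr p)"
    unfolding integral_diff[OF q s] by simp
  finally show ?thesis
    unfolding energy_eq_integral[OF assms(1,2) cont] energy_eq_integral[OF assms(1-3)]
      LINT_open_interval_continuous[OF in_W1p_per_integrable(3)[OF assms(1,2,4)]] by simp
qed

text \<open>The integral of \<open>(|u|\<^sup>p w)'\<close> vanishes by periodicity. For weakly differentiable \<open>u\<close>, the
  integrand is first compared on affine interpolants: these have, by Jensen's inequality, a smaller
  Dirichlet integral.\<close>
theorem picone: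
  assumes "p > 1" "T > 0" and eig: "log_eigen p T a \<mu> y w" and conta: "continuous_on {0..T} a"
    and W: "in_W1p_per p T u u'"
  shows "\<mu> * (LINT x:{0<..<T}|lborel. \<bar>u x\<bar> powr p) \<le> energy p T a u u'"
proof -
  \<comment> \<open>With the eigenvalue absorbed into the potential, the claim is that the energy
    for \<open>b\<close> is nonnegative.\<close>
  define b where "b x = a x - \<mu>" for x
  have contb: "continuous_on {0..T} b" unfolding b_def using conta by (intro continuous_intros)
  obtain B where "B > 0" and B: "\<And>x. x \<in> {0..T} \<Longrightarrow> \<bar>b x\<bar> \<le> B"
    by (rule continuous_Icc_bounded[OF contb]) (rule that)
  have contu: "continuous_on {0..T} u" and per: "u 0 = u T" and W': "in_W1p p {0<..<T} u u'"
    using W by (auto simp: in_W1p_per_def)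
  have w: "(w has_real_derivative b x - (p - 1) * \<bar>w x\<bar> powr (p / (p - 1))) (at x within {0..T})"
    if "x \<in> {0..T}" for x
    using eig that by (simp add: log_eigen_def b_def)
  note int_u' = LINT_open_interval_eq_integral(1)[OF in_W1p_per_integrable(1)[OF \<open>p > 1\<close> W conta]]
  have cont_bu: "continuous_on {0..T} (\<lambda>x. b x * \<bar>u x\<bar> powr p)"
    by (rule in_W1p_per_integrable(3)[OF \<open>p > 1\<close> W contb])
  note int_bu = integrable_continuous_real[OF cont_bu]
  define I where "I x = integral {0..x} (\<lambda>x. \<bar>u' x\<bar> powr p) + integral {0..x} (\<lambda>x. b x * \<bar>u x\<bar> powr p)" for x
  have I_diff: "I \<beta> - I \<alpha> = integral {\<alpha>..\<beta>} (\<lambda>x. \<bar>u' x\<bar> powr p) + integral {\<alpha>..\<beta>} (\<lambda>x. b x * \<bar>u x\<bar> powr p)"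
    if "0 \<le> \<alpha>" "\<alpha> \<le> \<beta>" "\<beta> \<le> T" for \<alpha> \<beta>
    using Henstock_Kurzweil_Integration.integral_combine[of 0 \<alpha> \<beta> "\<lambda>x. \<bar>u' x\<bar> powr p"]
      Henstock_Kurzweil_Integration.integral_combine[of 0 \<alpha> \<beta> "\<lambda>x. b x * \<bar>u x\<bar> powr p"]
      integrable_subinterval_real[OF int_u', of 0 \<beta>] integrable_subinterval_real[OF int_bu, of 0 \<beta>] that
    by (simp add: I_def)
  \<comment> \<open>Chord and u agree at both ends of a short interval, so |u|^p w has the same
    increment for both. The potential term may have either sign and costs the error \<epsilon>,
    through \<open>B * \<eta> = \<epsilon>\<close>.\<close>
  have "I 0 - \<bar>u 0\<bar> powr p * w 0 \<le> I T - \<bar>u T\<bar> powr p * w T"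
  proof (rule le_of_small_increments[OF \<open>T > 0\<close>])
    fix \<epsilon> :: real assume "\<epsilon> > 0"
    define \<eta> where "\<eta> = \<epsilon> / B"
    have "\<eta> > 0" using \<open>\<epsilon> > 0\<close> \<open>B > 0\<close> by (simp add: \<eta>_def)
    have "p > 0" using \<open>p > 1\<close> by simp
    obtain \<delta> where "\<delta> > 0" and \<delta>: "\<And>\<alpha> \<beta> x. \<lbrakk>0 \<le> \<alpha>; \<alpha> < \<beta>; \<beta> \<le> T; \<beta> - \<alpha> < \<delta>; x \<in> {\<alpha>..\<beta>}\<rbrakk> \<Longrightarrow>
        \<bar>\<bar>u \<alpha> + (u \<beta> - u \<alpha>) / (\<beta> - \<alpha>) * (x - \<alpha>)\<bar> powr p - \<bar>u x\<bar> powr p\<bar> \<le> \<eta>"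
      by (rule affine_interpolant_close[OF \<open>p > 0\<close> contu \<open>\<eta> > 0\<close>]) (rule that)
    have "- \<epsilon> * (\<beta> - \<alpha>) \<le> (I \<beta> - \<bar>u \<beta>\<bar> powr p * w \<beta>) - (I \<alpha> - \<bar>u \<alpha>\<bar> powr p * w \<alpha>)"
      if ab: "0 \<le> \<alpha>" "\<alpha> < \<beta>" "\<beta> \<le> T" "\<beta> - \<alpha> < \<delta>" for \<alpha> \<beta>
    proof -
      define s where "s = (u \<beta> - u \<alpha>) / (\<beta> - \<alpha>)"
      have end_point: "u \<alpha> + s * (\<beta> - \<alpha>) = u \<beta>" using ab by (simp add: s_def)
      have sub: "{\<alpha>..\<beta>} \<subseteq> {0..T}" using ab by auto
      have "\<bar>u \<alpha> + s * (\<beta> - \<alpha>)\<bar> powr p * w \<beta> - \<bar>u \<alpha>\<bar> powr p * w \<alpha>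
          \<le> (\<beta> - \<alpha>) * \<bar>s\<bar> powr p + integral {\<alpha>..\<beta>} (\<lambda>x. b x * \<bar>u \<alpha> + s * (x - \<alpha>)\<bar> powr p)"
      proof (rule riccati_affine[OF \<open>p > 1\<close> ab(2)])
        show "(w has_real_derivative b x - (p - 1) * \<bar>w x\<bar> powr (p / (p - 1))) (at x within {\<alpha>..\<beta>})"
          if "x \<in> {\<alpha>..\<beta>}" for x
          using that sub by (intro DERIV_subset[OF w]) auto
      qed (rule continuous_on_subset[OF contb sub])
      moreover have "(\<beta> - \<alpha>) * \<bar>s\<bar> powr p \<le> integral {\<alpha>..\<beta>} (\<lambda>x. \<bar>u' x\<bar> powr p)"
        using weak_derivative_jensen[OF \<open>p > 1\<close> W' contu] ab by (simp add: s_def)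
      moreover have "integral {\<alpha>..\<beta>} (\<lambda>x. b x * \<bar>u \<alpha> + s * (x - \<alpha>)\<bar> powr p)
          \<le> integral {\<alpha>..\<beta>} (\<lambda>x. b x * \<bar>u x\<bar> powr p + \<epsilon>)"
      proof (rule integral_le)
        show "b x * \<bar>u \<alpha> + s * (x - \<alpha>)\<bar> powr p \<le> b x * \<bar>u x\<bar> powr p + \<epsilon>" if "x \<in> {\<alpha>..\<beta>}" for x
        proof -
          let ?D = "\<bar>u \<alpha> + s * (x - \<alpha>)\<bar> powr p - \<bar>u x\<bar> powr p"
          have "b x * ?D \<le> \<bar>b x\<bar> * \<bar>?D\<bar>" using abs_ge_self[of "b x * ?D"] by (simp add: abs_mult)
          also have "\<dots> \<le> B * \<eta>"
            using B[of x] \<delta>[OF ab that] sub that \<open>B > 0\<close> by (intro mult_mono) (auto simp: s_def)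
          also have "\<dots> = \<epsilon>" using \<open>B > 0\<close> by (simp add: \<eta>_def)
          finally show ?thesis by (simp add: algebra_simps)
        qed
      qed (use \<open>p > 1\<close> in \<open>intro integrable_continuous_real continuous_intros
            continuous_on_subset[OF contb sub] continuous_on_subset[OF contu sub]; simp\<close>)+
      moreover have "integral {\<alpha>..\<beta>} (\<lambda>x. b x * \<bar>u x\<bar> powr p + \<epsilon>)
          = integral {\<alpha>..\<beta>} (\<lambda>x. b x * \<bar>u x\<bar> powr p) + (\<beta> - \<alpha>) * \<epsilon>"
        using integrable_subinterval_real[OF int_bu sub] ab by (subst integral_add) auto
      ultimately show ?thesis
        using I_diff[of \<alpha> \<beta>] ab unfolding end_point by (simp add: algebra_simps)
    qed
    then show "\<exists>\<delta>>0. \<forall>\<alpha> \<beta>. 0 \<le> \<alpha> \<longrightarrow> \<alpha> < \<beta> \<longrightarrow> \<beta> \<le> T \<longrightarrow> \<beta> - \<alpha> < \<delta> \<longrightarrow>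
      - \<epsilon> * (\<beta> - \<alpha>) \<le> (I \<beta> - \<bar>u \<beta>\<bar> powr p * w \<beta>) - (I \<alpha> - \<bar>u \<alpha>\<bar> powr p * w \<alpha>)"
      using \<open>\<delta> > 0\<close> by (intro exI[of _ \<delta>]) simp
  qed
  then have "0 \<le> I T" using eig per by (simp add: I_def log_eigen_def)
  also have "I T = energy p T b u u'"
    by (simp add: I_def energy_eq_integral[OF \<open>p > 1\<close> W contb])
  also have "\<dots> = energy p T a u u' - \<mu> * (LINT x:{0<..<T}|lborel. \<bar>u x\<bar> powr p)"
    unfolding b_def
    using energy_diff_weight[OF \<open>p > 1\<close> W conta continuous_on_const, of \<mu> 1] by simp
  finally show ?thesis by simp
qed

text \<open>The equality case of Picone's inequality: for u = exp y the derivative of u^p w is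
  exactly |u'|^p + (a - \<mu>) u^p, and its integral vanishes by periodicity.\<close>

lemma log_eigen_energy:
  assumes "p > 1" "T > 0" and eig: "log_eigen p T a \<mu> y w" and conta: "continuous_on {0..T} a"
  shows "in_W1p_per p T (\<lambda>x. exp (y x)) (\<lambda>x. exp (y x) * phi (p / (p - 1)) (w x))"
    and "energy p T a (\<lambda>x. exp (y x)) (\<lambda>x. exp (y x) * phi (p / (p - 1)) (w x))
      = \<mu> * (LINT x:{0<..<T}|lborel. \<bar>exp (y x)\<bar> powr p)"
proof -
  define r where "r = p / (p - 1)"
  have r: "r > 1" "(r - 1) * p = r" using \<open>p > 1\<close> by (simp_all add: r_def field_simps)
  have y: "(y has_real_derivative phi r (w x)) (at x within {0..T})" if "x \<in> {0..T}" for x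
    using eig that by (simp add: log_eigen_def r_def)
  have w: "(w has_real_derivative a x - \<mu> - (p - 1) * \<bar>w x\<bar> powr r) (at x within {0..T})"
    if "x \<in> {0..T}" for x
    using eig that by (simp add: log_eigen_def r_def)
  have cont_y: "continuous_on {0..T} y" by (rule DERIV_continuous_on[OF y])
  have cont_w: "continuous_on {0..T} w" by (rule DERIV_continuous_on[OF w])
  let ?u = "\<lambda>x. exp (y x)"
  let ?u' = "\<lambda>x. exp (y x) * phi r (w x)"
  have u: "(?u has_real_derivative ?u' x) (at x within {0..T})" if "x \<in> {0..T}" for x
    using y[OF that] by (auto intro!: derivative_eq_intros)
  show W: "in_W1p_per p T ?u (\<lambda>x. exp (y x) * phi (p / (p - 1)) (w x))"
    unfolding r_def[symmetric]
    using eig r by (intro C1_periodic_in_W1p_per \<open>p > 1\<close> \<open>T > 0\<close> u continuous_intros cont_y cont_w)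
      (auto simp: log_eigen_def)
  have contb: "continuous_on {0..T} (\<lambda>x. a x - \<mu>)" using conta by (intro continuous_intros)
  have up: "\<bar>?u x\<bar> powr p = exp (p * y x)" for x
    by (simp add: powr_def)
  have u'p: "\<bar>?u' x\<bar> powr p = exp (p * y x) * \<bar>w x\<bar> powr r" for x
    by (simp add: abs_mult abs_phi powr_mult powr_powr r(2)) (simp add: powr_def)
  have pw: "p * phi r (w x) * w x = p * \<bar>w x\<bar> powr r" for x
    using phi_mult_self[of r "w x"] by simp
  have "((\<lambda>x. exp (p * y x) * \<bar>w x\<bar> powr r + (a x - \<mu>) * exp (p * y x)) has_integral
      exp (p * y T) * w T - exp (p * y 0) * w 0) {0..T}"
  proof (rule fundamental_theorem_of_calculus)
    fix x assume x: "x \<in> {0..T}"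
    have "((\<lambda>x. exp (p * y x) * w x) has_real_derivative
        exp (p * y x) * (p * phi r (w x)) * w x + (a x - \<mu> - (p - 1) * \<bar>w x\<bar> powr r) * exp (p * y x))
        (at x within {0..T})"
      by (intro DERIV_mult w[OF x]) (auto intro!: derivative_eq_intros y[OF x])
    also have "exp (p * y x) * (p * phi r (w x)) * w x = exp (p * y x) * (p * \<bar>w x\<bar> powr r)"
      using pw[of x] by (simp only: mult.assoc)
    finally show "((\<lambda>x. exp (p * y x) * w x) has_vector_derivative
        exp (p * y x) * \<bar>w x\<bar> powr r + (a x - \<mu>) * exp (p * y x)) (at x within {0..T})"
      unfolding has_real_derivative_iff_has_vector_derivative[symmetric]
      by (rule DERIV_cong) (simp add: algebra_simps)
  qed (use \<open>T > 0\<close> in simp)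
  then have "integral {0..T} (\<lambda>x. exp (p * y x) * \<bar>w x\<bar> powr r + (a x - \<mu>) * exp (p * y x)) = 0"
    using eig by (simp add: integral_unique log_eigen_def)
  also have "integral {0..T} (\<lambda>x. exp (p * y x) * \<bar>w x\<bar> powr r + (a x - \<mu>) * exp (p * y x)) =
      integral {0..T} (\<lambda>x. exp (p * y x) * \<bar>w x\<bar> powr r) + integral {0..T} (\<lambda>x. (a x - \<mu>) * exp (p * y x))"
    using r by (intro integral_add integrable_continuous_real continuous_intros cont_y cont_w conta) auto
  also have "\<dots> = energy p T (\<lambda>x. a x - \<mu>) ?u ?u'"
    using energy_eq_integral[OF \<open>p > 1\<close> W contb] unfolding r_def[symmetric] u'p up by simp
  finally have "0 = energy p T (\<lambda>x. a x - \<mu>) ?u ?u'" by simp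
  also have "\<dots> = energy p T a ?u ?u' - \<mu> * (LINT x:{0<..<T}|lborel. \<bar>exp (y x)\<bar> powr p)"
    using energy_diff_weight[OF \<open>p > 1\<close> W conta continuous_on_const, of \<mu> 1] unfolding r_def[symmetric] by simp
  finally show "energy p T a ?u (\<lambda>x. exp (y x) * phi (p / (p - 1)) (w x))
      = \<mu> * (LINT x:{0<..<T}|lborel. \<bar>exp (y x)\<bar> powr p)"
    unfolding r_def[symmetric] by simp
qed

lemma integral_continuous_pos:
  fixes g :: "real \<Rightarrow> real"
  assumes "T > 0" "continuous_on {0..T} g" "\<And>x. x \<in> {0..T} \<Longrightarrow> g x \<ge> 0" "z \<in> {0..T}" "g z \<noteq> 0"
  shows "integral {0..T} g > 0"
proof -
  have "integral {0..T} g \<ge> 0"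
    using assms by (intro integral_nonneg integrable_continuous_real) auto
  moreover have "integral {0..T} g \<noteq> 0"
    using integral_eq_0_iff[OF assms(2) \<open>T > 0\<close>] assms by blast
  ultimately show ?thesis by simp
qed

lemma energy_pos:
  assumes "p > 1" "T > 0" and contq: "continuous_on {0..T} q"
    and q: "\<And>x. x \<in> {0..T} \<Longrightarrow> q x \<ge> 0" "\<exists>x\<in>{0..T}. q x \<noteq> 0"
    and W: "in_W1p_per p T u u'" and u: "\<And>x. x \<in> {0..T} \<Longrightarrow> u x \<noteq> 0"
  shows "energy p T q u u' > 0"
proof -
  obtain z where z: "z \<in> {0..T}" "q z \<noteq> 0" using q by blast
  have "integral {0..T} (\<lambda>x. q x * \<bar>u x\<bar> powr p) > 0"
    using q(1) z u[OF z(1)]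
    by (intro integral_continuous_pos[OF \<open>T > 0\<close> in_W1p_per_integrable(3)[OF \<open>p > 1\<close> W contq], of z]) auto
  moreover have "integral {0..T} (\<lambda>x. \<bar>u' x\<bar> powr p) \<ge> 0"
    by (rule integral_nonneg[OF LINT_open_interval_eq_integral(1)[OF in_W1p_per_integrable(1)[OF \<open>p > 1\<close> W contq]]]) simp
  ultimately show ?thesis using energy_eq_integral[OF \<open>p > 1\<close> W contq] by simp
qed

text \<open>The function is a bump supported in an interval on which m > 0; the squared positive
  parts make it continuously differentiable, and it vanishes at both 0 and T.\<close>

lemma weight_positive_somewhere:
  assumes "p > 1" "T > 0" and contm: "continuous_on {0..T} m" and "\<exists>x\<in>{0..T}. m x > 0"
  obtains u u' where "in_W1p_per p T u u'" "(LINT x:{0<..<T}|lborel. m x * \<bar>u x\<bar> powr p) > 0"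
proof -
  obtain z where z: "z \<in> {0..T}" "m z > 0" using assms by blast
  then obtain d where "d > 0" and d: "\<And>x. x \<in> {0..T} \<Longrightarrow> \<bar>x - z\<bar> < d \<Longrightarrow> \<bar>m x - m z\<bar> < m z"
    using contm unfolding continuous_on_iff dist_real_def by metis
  define \<alpha> where "\<alpha> = max 0 (z - d / 2)"
  define \<beta> where "\<beta> = min T (z + d / 2)"
  have ab: "0 \<le> \<alpha>" "\<alpha> < \<beta>" "\<beta> \<le> T" using z \<open>d > 0\<close> \<open>T > 0\<close> by (auto simp: \<alpha>_def \<beta>_def)
  have m_pos: "m x > 0" if "x \<in> {\<alpha>..\<beta>}" for x
  proof -
    have "\<bar>x - z\<bar> < d" using that \<open>d > 0\<close> by (auto simp: \<alpha>_def \<beta>_def)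
    then show ?thesis using d[of x] that ab by auto
  qed
  define u where "u x = (max 0 (x - \<alpha>))\<^sup>2 * (max 0 (\<beta> - x))\<^sup>2" for x
  define u' where "u' x = 2 * max 0 (x - \<alpha>) * (max 0 (\<beta> - x))\<^sup>2
      + (2 * max 0 (\<beta> - x) * (- 1)) * (max 0 (x - \<alpha>))\<^sup>2" for x
  have d1: "((\<lambda>x. x - \<alpha>) has_real_derivative 1) (at x within {0..T})"
      "((\<lambda>x. \<beta> - x) has_real_derivative - 1) (at x within {0..T})" for x
    by (auto intro!: derivative_eq_intros)
  have d2: "((\<lambda>x. (max 0 (x - \<alpha>))\<^sup>2) has_real_derivative 2 * max 0 (x - \<alpha>)) (at x within {0..T})"
      "((\<lambda>x. (max 0 (\<beta> - x))\<^sup>2) has_real_derivative 2 * max 0 (\<beta> - x) * (- 1)) (at x within {0..T})" for x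
    using DERIV_chain2[OF has_real_derivative_pos_part_power2 d1(1)]
      DERIV_chain2[OF has_real_derivative_pos_part_power2 d1(2)] by simp_all
  have "(u has_real_derivative u' x) (at x within {0..T})" for x
    unfolding u_def[abs_def] u'_def by (intro DERIV_mult d2)
  moreover have "continuous_on {0..T} u'" unfolding u'_def by (intro continuous_intros)
  moreover have "u 0 = u T" using ab by (simp add: u_def)
  ultimately have W: "in_W1p_per p T u u'" by (intro C1_periodic_in_W1p_per assms)
  have outside: "u x = 0" if "x \<notin> {\<alpha>..\<beta>}" for x
    using that by (auto simp: u_def max_def)
  have "integral {0..T} (\<lambda>x. m x * \<bar>u x\<bar> powr p) > 0"
  proof (rule integral_continuous_pos[OF \<open>T > 0\<close> in_W1p_per_integrable(3)[OF \<open>p > 1\<close> W contm]])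
    show "m x * \<bar>u x\<bar> powr p \<ge> 0" for x
      using m_pos[of x] outside[of x] by (cases "x \<in> {\<alpha>..\<beta>}") auto
    show "(\<alpha> + \<beta>) / 2 \<in> {0..T}" using ab by auto
    have "m ((\<alpha> + \<beta>) / 2) > 0" using ab by (intro m_pos) auto
    moreover have "u ((\<alpha> + \<beta>) / 2) > 0" using ab by (simp add: u_def max_def field_simps)
    ultimately show "m ((\<alpha> + \<beta>) / 2) * \<bar>u ((\<alpha> + \<beta>) / 2)\<bar> powr p \<noteq> 0" by simp
  qed
  then show ?thesis
    using that W LINT_open_interval_continuous[OF in_W1p_per_integrable(3)[OF \<open>p > 1\<close> W contm]] by simp
qed

section \<open>Weighted eigenvalues and solutions of the nonlinear problem\<close>

text \<open>Homogeneity: \<open>exp y\<close> may be scaled by a positive constant.\<close>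

lemma log_eigen_shift:
  "log_eigen p T a \<mu> y w \<Longrightarrow> log_eigen p T a \<mu> (\<lambda>x. y x - c) w"
  by (auto simp: log_eigen_def intro!: derivative_eq_intros)

text \<open>The principal eigenvalue \<mu>(s) for q - s m is Lipschitz in s, positive at s = 0
  because q does not vanish identically, and negative for large s by Picone's inequality for a bump
  where m > 0. At a zero s > 0 the eigenfunction has energy s times its weighted integral, so this
  integral is positive and can be normalized.\<close>

lemma exists_critical_log_eigen:
  assumes "p > 1" "T > 0" and contq: "continuous_on {0..T} q"
    and q: "\<And>x. x \<in> {0..T} \<Longrightarrow> q x \<ge> 0" "\<exists>x\<in>{0..T}. q x \<noteq> 0"
    and contm: "continuous_on {0..T} m" and m: "\<exists>x\<in>{0..T}. m x > 0"
  obtains s y w where "s > 0" "log_eigen p T (\<lambda>x. q x - s * m x) 0 y w"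
    "(LINT x:{0<..<T}|lborel. m x * \<bar>exp (y x)\<bar> powr p) = 1"
proof -
  have conta: "continuous_on {0..T} (\<lambda>x. q x - s * m x)" for s
    by (intro continuous_intros contq contm)
  have "\<exists>\<mu> y w. log_eigen p T (\<lambda>x. q x - s * m x) \<mu> y w" for s
    by (rule log_eigen_exists_linear[OF \<open>p > 1\<close> \<open>T > 0\<close> conta]) blast
  then obtain \<mu> y w where eig: "\<And>s. log_eigen p T (\<lambda>x. q x - s * m x) (\<mu> s) (y s) (w s)"
    by metis
  define U where "U s x = exp (y s x)" for s x
  define U' where "U' s x = exp (y s x) * phi (p / (p - 1)) (w s x)" for s x
  have W: "in_W1p_per p T (U s) (U' s)"
    and E: "energy p T (\<lambda>x. q x - s * m x) (U s) (U' s) = \<mu> s * (LINT x:{0<..<T}|lborel. \<bar>U s x\<bar> powr p)" for s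
    using log_eigen_energy[OF \<open>p > 1\<close> \<open>T > 0\<close> eig conta] unfolding U_def[abs_def] U'_def[abs_def] by auto
  have E_pos: "energy p T q (U s) (U' s) > 0" for s
    by (rule energy_pos[OF \<open>p > 1\<close> \<open>T > 0\<close> contq q W]) (auto simp: U_def)
  have mass_nonneg: "(LINT x:{0<..<T}|lborel. \<bar>u x\<bar> powr p) \<ge> 0" for u
    unfolding set_lebesgue_integral_def by (intro Bochner_Integration.integral_nonneg) simp
  obtain B where "B > 0" and B: "\<And>x. x \<in> {0..T} \<Longrightarrow> \<bar>m x\<bar> \<le> B"
    by (rule continuous_Icc_bounded[OF contm]) (rule that)
  have lip: "\<bar>\<mu> s - \<mu> t\<bar> \<le> \<bar>s - t\<bar> * B" for s t
  proof (rule log_eigen_compare[OF \<open>p > 1\<close> \<open>T > 0\<close> eig eig])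
    fix x assume x: "x \<in> {0..T}"
    have "\<bar>(q x - s * m x) - (q x - t * m x)\<bar> = \<bar>s - t\<bar> * \<bar>m x\<bar>"
      by (simp add: abs_mult[symmetric] abs_minus_commute algebra_simps)
    also have "\<dots> \<le> \<bar>s - t\<bar> * B" using B[OF x] by (intro mult_left_mono) auto
    finally show "\<bar>(q x - s * m x) - (q x - t * m x)\<bar> \<le> \<bar>s - t\<bar> * B" .
  qed
  have cont: "continuous_on UNIV \<mu>"
  proof (rule lipschitz_on_continuous_on[OF lipschitz_onI])
    show "dist (\<mu> s) (\<mu> t) \<le> B * dist s t" for s t
      using lip[of s t] by (simp add: dist_real_def mult.commute)
  qed (use \<open>B > 0\<close> in simp)
  have "\<mu> 0 > 0"
  proof (rule ccontr)
    assume "\<not> \<mu> 0 > 0"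
    then have "\<mu> 0 * (LINT x:{0<..<T}|lborel. \<bar>U 0 x\<bar> powr p) \<le> 0"
      using mass_nonneg[of "U 0"] by (intro mult_nonpos_nonneg) auto
    then show False using E[of 0] E_pos[of 0] by simp
  qed
  obtain v v' where v: "in_W1p_per p T v v'" and \<kappa>: "(LINT x:{0<..<T}|lborel. m x * \<bar>v x\<bar> powr p) > 0"
    by (rule weight_positive_somewhere[OF \<open>p > 1\<close> \<open>T > 0\<close> contm m]) (rule that)
  \<comment> \<open>With this t the energy of v for the potential q - t m is at most -1.\<close>
  define t where "t = (\<bar>energy p T q v v'\<bar> + 1) / (LINT x:{0<..<T}|lborel. m x * \<bar>v x\<bar> powr p)"
  have "t > 0" using \<kappa> by (simp add: t_def)
  have "\<mu> t * (LINT x:{0<..<T}|lborel. \<bar>v x\<bar> powr p) \<le> energy p T (\<lambda>x. q x - t * m x) v v'"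
    by (rule picone[OF \<open>p > 1\<close> \<open>T > 0\<close> eig conta v])
  also have "\<dots> = energy p T q v v' - t * (LINT x:{0<..<T}|lborel. m x * \<bar>v x\<bar> powr p)"
    by (rule energy_diff_weight[OF \<open>p > 1\<close> v contq contm])
  also have "\<dots> < 0" using \<kappa> by (simp add: t_def)
  finally have "\<mu> t < 0" using mass_nonneg[of v] by (simp add: mult_less_0_iff)
  then obtain s where s: "0 \<le> s" "s \<le> t" "\<mu> s = 0"
    using IVT2'[of \<mu> t 0 0] \<open>\<mu> 0 > 0\<close> \<open>t > 0\<close> continuous_on_subset[OF cont subset_UNIV] by auto
  have "s > 0" using s \<open>\<mu> 0 > 0\<close> by (cases "s = 0") auto
  define I where "I = (LINT x:{0<..<T}|lborel. m x * \<bar>U s x\<bar> powr p)"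
  have "energy p T q (U s) (U' s) = s * I"
    using E[of s] energy_diff_weight[OF \<open>p > 1\<close> W contq contm, of s s] s(3) by (simp add: I_def)
  then have "I > 0" using E_pos[of s] \<open>s > 0\<close> by (simp add: zero_less_mult_iff)
  \<comment> \<open>Lowering y by this amount divides exp(p y), and with it the weighted integral,
    by \<open>I\<close>.\<close>
  define c where "c = ln I / p"
  have "\<bar>exp (y s x - c)\<bar> powr p = \<bar>U s x\<bar> powr p / I" for x
  proof -
    have "p * (y s x - c) = p * y s x - ln I" using \<open>p > 1\<close> by (simp add: c_def field_simps)
    moreover have "exp (p * y s x - ln I) = exp (p * y s x) / I" using \<open>I > 0\<close> by (simp add: exp_diff)
    ultimately show ?thesis by (simp add: U_def powr_def)
  qed
  then have "(LINT x:{0<..<T}|lborel. m x * \<bar>exp (y s x - c)\<bar> powr p) = I / I"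
    unfolding I_def by (simp add: times_divide_eq_right[symmetric] del: times_divide_eq_right)
      (simp add: set_integral_divide_zero)
  then have "(LINT x:{0<..<T}|lborel. m x * \<bar>exp (y s x - c)\<bar> powr p) = 1"
    using \<open>I > 0\<close> by simp
  moreover have "log_eigen p T (\<lambda>x. q x - s * m x) 0 (\<lambda>x. y s x - c) (w s)"
    using log_eigen_shift[OF eig[of s]] s(3) by simp
  ultimately show ?thesis using that \<open>s > 0\<close> by blast
qed

text \<open>Picone's inequality with \<mu> = 0 bounds the energy for q below by s times the weighted
  integral, with equality for exp y. So the least energy is attained, and it is s.\<close>

lemma critical_least_energy:
  assumes "p > 1" "T > 0" and contq: "continuous_on {0..T} q" and contm: "continuous_on {0..T} m"
    and eig: "log_eigen p T (\<lambda>x. q x - s * m x) 0 y w"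
    and norm: "(LINT x:{0<..<T}|lborel. m x * \<bar>exp (y x)\<bar> powr p) = 1"
  defines "S \<equiv> {energy p T q u u' | u u'. in_W1p_per p T u u' \<and>
            (LINT x:{0<..<T}|lborel. m x * \<bar>u x\<bar> powr p) = 1}"
  shows "s \<in> S" and "\<And>e. e \<in> S \<Longrightarrow> s \<le> e"
proof -
  have conta: "continuous_on {0..T} (\<lambda>x. q x - s * m x)"
    by (intro continuous_intros contq contm)
  note U = log_eigen_energy[OF \<open>p > 1\<close> \<open>T > 0\<close> eig conta]
  have "energy p T q (\<lambda>x. exp (y x)) (\<lambda>x. exp (y x) * phi (p / (p - 1)) (w x)) = s"
    using U(2) energy_diff_weight[OF \<open>p > 1\<close> U(1) contq contm, of s] norm by simp
  then show "s \<in> S" unfolding S_def using U(1) norm by blast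
  show "s \<le> e" if "e \<in> S" for e
  proof -
    from that obtain u u' where u: "in_W1p_per p T u u'" "e = energy p T q u u'"
      "(LINT x:{0<..<T}|lborel. m x * \<bar>u x\<bar> powr p) = 1"
      by (auto simp: S_def)
    show ?thesis
      using picone[OF \<open>p > 1\<close> \<open>T > 0\<close> eig conta u(1)]
        energy_diff_weight[OF \<open>p > 1\<close> u(1) contq contm, of s] u by simp
  qed
qed

lemma lambda0_plus_eq:
  assumes "p > 1" "T > 0" "continuous_on {0..T} q" "continuous_on {0..T} m"
    and "log_eigen p T (\<lambda>x. q x - s * m x) 0 y w"
    and "(LINT x:{0<..<T}|lborel. m x * \<bar>exp (y x)\<bar> powr p) = 1"
  shows "lambda0_plus p T q m = s"
  unfolding lambda0_plus_def by (rule cInf_eq_minimum; rule critical_least_energy[OF assms])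

text \<open>The least energy for the weight -m is attained, so its negative is a greatest element
  and the \<open>GREATEST\<close> in the definition denotes it.\<close>

lemma lambda0_minus_eq:
  assumes "p > 1" "T > 0" "continuous_on {0..T} q" "continuous_on {0..T} m"
    and "log_eigen p T (\<lambda>x. q x - s * - m x) 0 y w"
    and "(LINT x:{0<..<T}|lborel. - m x * \<bar>exp (y x)\<bar> powr p) = 1"
  shows "lambda0_minus p T q m = - s"
proof -
  have "continuous_on {0..T} (\<lambda>x. - m x)" using assms by (intro continuous_intros)
  note least = critical_least_energy[OF assms(1-3) this assms(5,6)]
  show ?thesis
    unfolding lambda0_minus_def
  proof (rule Greatest_equality)
    show "- s \<in> {- energy p T q u u' | u u'. in_W1p_per p T u u' \<and>
            (LINT x:{0<..<T}|lborel. - m x * \<bar>u x\<bar> powr p) = 1}"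
      using least(1) by blast
    show "l \<le> - s" if "l \<in> {- energy p T q u u' | u u'. in_W1p_per p T u u' \<and>
            (LINT x:{0<..<T}|lborel. - m x * \<bar>u x\<bar> powr p) = 1}" for l
    proof -
      have "- l \<in> {energy p T q u u' | u u'. in_W1p_per p T u u' \<and>
            (LINT x:{0<..<T}|lborel. - m x * \<bar>u x\<bar> powr p) = 1}"
        using that by force
      then show ?thesis using least(2)[of "- l"] by simp
    qed
  qed
qed

text \<open>Below \<open>s0\<close>, the eigenfunction u for s is tested in the critical problem: E
  \<ge> s0 J and E > 0, with J its weighted integral, give E - s J > 0 whatever the sign of J. Above
  \<open>s0\<close>, the critical function is tested in the problem for s, where its energy is s0 -
  s < 0.\<close>

lemma log_eigen_sign:
  assumes "p > 1" "T > 0" and contq: "continuous_on {0..T} q"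
    and q: "\<And>x. x \<in> {0..T} \<Longrightarrow> q x \<ge> 0" "\<exists>x\<in>{0..T}. q x \<noteq> 0"
    and contm: "continuous_on {0..T} m"
    and crit: "log_eigen p T (\<lambda>x. q x - s0 * m x) 0 y0 w0"
      "(LINT x:{0<..<T}|lborel. m x * \<bar>exp (y0 x)\<bar> powr p) = 1"
    and eig: "log_eigen p T (\<lambda>x. q x - s * m x) \<mu> y w"
  shows "0 \<le> s \<Longrightarrow> s < s0 \<Longrightarrow> \<mu> > 0" and "s0 < s \<Longrightarrow> \<mu> < 0"
proof -
  have conta: "continuous_on {0..T} (\<lambda>x. q x - s * m x)" for s
    by (intro continuous_intros contq contm)
  have mass_nonneg: "(LINT x:{0<..<T}|lborel. \<bar>u x\<bar> powr p) \<ge> 0" for u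
    unfolding set_lebesgue_integral_def by (intro Bochner_Integration.integral_nonneg) simp
  let ?u = "\<lambda>x. exp (y x)" and ?u' = "\<lambda>x. exp (y x) * phi (p / (p - 1)) (w x)"
  let ?v = "\<lambda>x. exp (y0 x)" and ?v' = "\<lambda>x. exp (y0 x) * phi (p / (p - 1)) (w0 x)"
  note U = log_eigen_energy[OF \<open>p > 1\<close> \<open>T > 0\<close> eig conta]
  note V = log_eigen_energy[OF \<open>p > 1\<close> \<open>T > 0\<close> crit(1) conta]
  define J where "J = (LINT x:{0<..<T}|lborel. m x * \<bar>?u x\<bar> powr p)"
  have E_pos: "energy p T q ?u ?u' > 0"
    by (rule energy_pos[OF \<open>p > 1\<close> \<open>T > 0\<close> contq q U(1)]) auto
  have split: "energy p T (\<lambda>x. q x - t * m x) ?u ?u' = energy p T q ?u ?u' - t * J" for t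
    unfolding J_def by (rule energy_diff_weight[OF \<open>p > 1\<close> U(1) contq contm])
  show "\<mu> > 0" if "0 \<le> s" "s < s0"
  proof -
    have "energy p T q ?u ?u' \<ge> s0 * J"
      using picone[OF \<open>p > 1\<close> \<open>T > 0\<close> crit(1) conta U(1)] split[of s0] by simp
    then have "energy p T q ?u ?u' - s * J > 0"
      using E_pos that by (cases "J > 0")
        (auto intro: less_le_trans[OF mult_strict_right_mono] order.strict_trans1[OF mult_nonneg_nonpos])
    then have "\<mu> * (LINT x:{0<..<T}|lborel. \<bar>?u x\<bar> powr p) > 0"
      using U(2) split[of s] by simp
    then show ?thesis using mass_nonneg[of ?u] by (simp add: zero_less_mult_iff)
  qed
  show "\<mu> < 0" if "s0 < s"
  proof -
    have "\<mu> * (LINT x:{0<..<T}|lborel. \<bar>?v x\<bar> powr p) \<le> energy p T (\<lambda>x. q x - s * m x) ?v ?v'"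
      by (rule picone[OF \<open>p > 1\<close> \<open>T > 0\<close> eig conta V(1)])
    also have "\<dots> = s0 - s"
      using energy_diff_weight[OF \<open>p > 1\<close> V(1) contq contm, of s]
        energy_diff_weight[OF \<open>p > 1\<close> V(1) contq contm, of s0] V(2) crit(2) by simp
    finally show ?thesis using that mass_nonneg[of ?v] by (smt (verit) mult_nonneg_nonneg)
  qed
qed

section \<open>The nonlinear problem\<close>

lemma continuous_bounded_of_limits:
  fixes g :: "real \<Rightarrow> real"
  assumes cont: "continuous_on UNIV g" and bot: "(g \<longlongrightarrow> l) at_bot" and top: "(g \<longlongrightarrow> l') at_top"
  obtains B where "B > 0" "\<And>y. \<bar>g y\<bar> \<le> B"
proof -
  have "\<forall>\<^sub>F y in at_bot. \<bar>g y - l\<bar> < 1" "\<forall>\<^sub>F y in at_top. \<bar>g y - l'\<bar> < 1"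
    using tendstoD[OF bot, of 1] tendstoD[OF top, of 1] by (auto simp: dist_real_def)
  then obtain a b where a: "\<And>y. y \<le> a \<Longrightarrow> \<bar>g y - l\<bar> < 1" and b: "\<And>y. y \<ge> b \<Longrightarrow> \<bar>g y - l'\<bar> < 1"
    unfolding eventually_at_bot_linorder eventually_at_top_linorder by blast
  obtain B where "B > 0" and B: "\<And>y. y \<in> {a..b} \<Longrightarrow> \<bar>g y\<bar> \<le> B"
    by (rule continuous_Icc_bounded[OF continuous_on_subset[OF cont subset_UNIV]]) (rule that)
  have "\<bar>g y\<bar> \<le> B + \<bar>l\<bar> + \<bar>l'\<bar> + 1" for y
  proof -
    consider "y \<le> a" | "y \<ge> b" | "y \<in> {a..b}" by force
    then show ?thesis
      using a[of y] b[of y] B[of y] \<open>B > 0\<close> by cases auto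
  qed
  then show ?thesis using that[of "B + \<bar>l\<bar> + \<bar>l'\<bar> + 1"] \<open>B > 0\<close> by simp
qed

text \<open>As \<open>phi p\<close> inverts \<open>phi (p / (p - 1))\<close>, it maps u' to
  \<open>exp ((p - 1) * y x) * w x\<close>. This product is differentiable even where u' is
  not.\<close>

lemma log_eigen_classical_solution:
  assumes "p > 1"
    and eig: "log_eigen p T (\<lambda>x. q x - lam * m x * (f (exp (y x)) / phi p (exp (y x)))) 0 y w"
  shows "classical_solution p T q m f lam (\<lambda>x. exp (y x))"
proof -
  define r where "r = p / (p - 1)"
  have r: "r > 1" using \<open>p > 1\<close> by (simp add: r_def)
  have y: "(y has_real_derivative phi r (w x)) (at x within {0..T})" if "x \<in> {0..T}" for x
    using eig that by (simp add: log_eigen_def r_def)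
  define a where "a x = q x - lam * m x * (f (exp (y x)) / phi p (exp (y x)))" for x
  have w: "(w has_real_derivative a x - (p - 1) * \<bar>w x\<bar> powr r) (at x within {0..T})"
    if "x \<in> {0..T}" for x
    using eig that by (simp add: log_eigen_def r_def a_def)
  let ?v = "\<lambda>x. exp (y x) * phi r (w x)"
  have phi_exp: "phi p (exp t) = exp ((p - 1) * t)" for t
    by (simp add: phi_pos powr_def)
  have phi_v: "phi p (?v x) = exp ((p - 1) * y x) * w x" for x
    using phi_conjugate[OF \<open>p > 1\<close>, of "w x"] by (simp add: phi_mult phi_exp r_def)
  show ?thesis
    unfolding classical_solution_def
  proof (intro exI[of _ ?v] conjI ballI)
    fix x assume x: "x \<in> {0<..<T}"
    then have at: "at x within {0..T} = at x" by (simp add: at_within_Icc_at)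
    define e where "e = exp ((p - 1) * y x)"
    have "e > 0" by (simp add: e_def)
    have "((\<lambda>x. exp ((p - 1) * y x) * w x) has_real_derivative
        e * ((p - 1) * phi r (w x)) * w x + (a x - (p - 1) * \<bar>w x\<bar> powr r) * e) (at x)"
      using y[of x] w[of x] x unfolding e_def at by (auto intro!: derivative_eq_intros)
    moreover have "e * ((p - 1) * phi r (w x)) * w x = e * (p - 1) * \<bar>w x\<bar> powr r"
      using phi_mult_self[of r "w x"] by (simp add: mult.assoc)
    ultimately have "((\<lambda>x. phi p (?v x)) has_real_derivative e * a x) (at x)"
      unfolding phi_v by (simp add: algebra_simps)
    moreover have "phi p (exp (y x)) = e" by (simp add: phi_exp e_def)
    then have "- (e * a x) + q x * phi p (exp (y x)) = lam * m x * f (exp (y x))"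
      using \<open>e > 0\<close> by (simp add: a_def field_simps)
    ultimately show "\<exists>d. ((\<lambda>t. phi p (?v t)) has_real_derivative d) (at x) \<and>
        - d + q x * phi p (exp (y x)) = lam * m x * f (exp (y x))" by blast
  next
    show "((\<lambda>x. exp (y x)) has_real_derivative ?v x) (at x within {0..T})" if "x \<in> {0..T}" for x
      using y[OF that] by (auto intro!: derivative_eq_intros)
    show "continuous_on {0..T} ?v"
      by (intro continuous_intros r DERIV_continuous_on[OF y] DERIV_continuous_on[OF w])
  qed (use eig in \<open>auto simp: log_eigen_def\<close>)
qed

theorem positive_solution_exists:
  fixes q m f :: "real \<Rightarrow> real"
  assumes "T > 0" "p > 1" and contq: "continuous_on {0..T} q"
    and q: "\<And>x. x \<in> {0..T} \<Longrightarrow> q x \<ge> 0" "\<exists>x\<in>{0..T}. q x \<noteq> 0"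
    and contm: "continuous_on {0..T} m"
    and contf: "continuous_on UNIV f"
    and f0: "((\<lambda>s. f s / phi p s) \<longlongrightarrow> f0) (at 0)" "f0 > 0"
    and finf: "((\<lambda>s. f s / phi p s) \<longlongrightarrow> finf) at_infinity" "finf > 0"
    and "s0 > 0" and crit: "log_eigen p T (\<lambda>x. q x - s0 * m x) 0 y0 w0"
      "(LINT x:{0<..<T}|lborel. m x * \<bar>exp (y0 x)\<bar> powr p) = 1"
    and lam: "lam \<in> {s0 / finf<..<s0 / f0} \<union> {s0 / f0<..<s0 / finf}"
  shows "\<exists>u. classical_solution p T q m f lam u \<and> (\<forall>x\<in>{0..T}. u x > 0)"
proof -
  have "lam > 0"
    using lam divide_pos_pos[OF \<open>s0 > 0\<close> \<open>f0 > 0\<close>] divide_pos_pos[OF \<open>s0 > 0\<close> \<open>finf > 0\<close>] by auto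
  \<comment> \<open>The factors of m in the two limit problems lie on opposite sides of the critical
    value \<open>s0\<close>.\<close>
  have lam_cases: "lam * f0 < s0 \<and> s0 < lam * finf \<or> lam * finf < s0 \<and> s0 < lam * f0"
    using lam \<open>f0 > 0\<close> \<open>finf > 0\<close> by (auto simp: field_simps)
  define g where "g y = f (exp y) / phi p (exp y)" for y
  have contg: "continuous_on UNIV g"
    unfolding g_def using \<open>p > 1\<close>
    by (intro continuous_intros continuous_on_compose2[OF contf]) auto
  have g_bot: "(g \<longlongrightarrow> f0) at_bot"
  proof -
    have "filterlim (exp :: real \<Rightarrow> real) (at 0) at_bot"
      unfolding filterlim_at using exp_at_bot by auto
    then show ?thesis unfolding g_def by (rule filterlim_compose[OF f0(1)])
  qed
  have g_top: "(g \<longlongrightarrow> finf) at_top"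
    unfolding g_def
    by (rule filterlim_compose[OF finf(1) filterlim_compose[OF filterlim_at_top_imp_at_infinity[OF filterlim_ident] exp_at_top]])
  obtain G where "G > 0" and G: "\<And>y. \<bar>g y\<bar> \<le> G"
    by (rule continuous_bounded_of_limits[OF contg g_bot g_top]) (rule that)
  obtain Q where "Q > 0" and Q: "\<And>x. x \<in> {0..T} \<Longrightarrow> \<bar>q x\<bar> \<le> Q"
    by (rule continuous_Icc_bounded[OF contq]) (rule that)
  obtain M where "M > 0" and M: "\<And>x. x \<in> {0..T} \<Longrightarrow> \<bar>m x\<bar> \<le> M"
    by (rule continuous_Icc_bounded[OF contm]) (rule that)
  define a where "a x y = q x - lam * m x * g y" for x y
  define A where "A = Q + lam * M * G"
  have a_bound: "\<bar>a x y\<bar> \<le> A" if "x \<in> {0..T}" for x y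
  proof -
    have "\<bar>a x y\<bar> \<le> \<bar>q x\<bar> + \<bar>lam * m x * g y\<bar>" unfolding a_def by (rule abs_triangle_ineq4)
    also have "\<bar>lam * m x * g y\<bar> \<le> lam * M * G"
      unfolding abs_mult using M[OF that] G[of y] \<open>lam > 0\<close> \<open>M > 0\<close> by (intro mult_mono) auto
    finally show ?thesis using Q[OF that] by (simp add: A_def)
  qed
  have conta: "continuous_on ({0..T} \<times> UNIV) (\<lambda>(x, y). a x y)"
  proof -
    have "continuous_on ({0..T} \<times> UNIV) (\<lambda>z::real \<times> real. q (fst z))"
      "continuous_on ({0..T} \<times> UNIV) (\<lambda>z::real \<times> real. m (fst z))"
      "continuous_on ({0..T} \<times> UNIV) (\<lambda>z::real \<times> real. g (snd z))"
      by (rule continuous_on_compose2[OF contq] continuous_on_compose2[OF contm]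
          continuous_on_compose2[OF contg]; auto intro!: continuous_intros)+
    then show ?thesis unfolding a_def case_prod_unfold by (intro continuous_intros)
  qed
  have lin: "continuous_on {0..T} (\<lambda>x. q x - lam * k * m x)" for k
    by (intro continuous_intros contq contm)
  obtain \<mu>0 y1 w1 where eig0: "log_eigen p T (\<lambda>x. q x - lam * f0 * m x) \<mu>0 y1 w1"
    by (rule log_eigen_exists_linear[OF \<open>p > 1\<close> \<open>T > 0\<close> lin]) (rule that)
  obtain \<mu>inf y2 w2 where eiginf: "log_eigen p T (\<lambda>x. q x - lam * finf * m x) \<mu>inf y2 w2"
    by (rule log_eigen_exists_linear[OF \<open>p > 1\<close> \<open>T > 0\<close> lin]) (rule that)
  note sign0 = log_eigen_sign[OF \<open>p > 1\<close> \<open>T > 0\<close> contq q contm crit eig0]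
  note signinf = log_eigen_sign[OF \<open>p > 1\<close> \<open>T > 0\<close> contq q contm crit eiginf]
  have opposite: "\<mu>0 > 0 \<and> \<mu>inf < 0 \<or> \<mu>0 < 0 \<and> \<mu>inf > 0"
    using lam_cases sign0 signinf \<open>lam > 0\<close> f0(2) finf(2) by (auto simp: less_imp_le)
  \<comment> \<open>If g is this close to its limit, the potentials differ by at most half the
    smaller modulus of the two limit eigenvalues, so \<mu> inherits the sign of the nearby
    one.\<close>
  define \<epsilon> where "\<epsilon> = min \<bar>\<mu>0\<bar> \<bar>\<mu>inf\<bar> / (2 * lam * M)"
  have "\<epsilon> > 0" using opposite \<open>lam > 0\<close> \<open>M > 0\<close> by (auto simp: \<epsilon>_def)
  obtain b1 where b1: "\<And>y. y \<le> b1 \<Longrightarrow> \<bar>g y - f0\<bar> < \<epsilon>"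
    using tendstoD[OF g_bot \<open>\<epsilon> > 0\<close>] by (auto simp: eventually_at_bot_linorder dist_real_def)
  obtain b2 where b2: "\<And>y. y \<ge> b2 \<Longrightarrow> \<bar>g y - finf\<bar> < \<epsilon>"
    using tendstoD[OF g_top \<open>\<epsilon> > 0\<close>] by (auto simp: eventually_at_top_linorder dist_real_def)
  define L where "L = phi (p / (p - 1)) (slope_bound p A) * T"
  \<comment> \<open>As y oscillates by at most \<open>L\<close>, starting at \<open>C\<close> keeps
    y above \<open>b2\<close>, and starting at \<open>- C\<close> keeps it below
    \<open>b1\<close>.\<close>
  define C where "C = max 0 (max (b2 + L) (L - b1))"
  obtain \<mu> y w where eig: "log_eigen p T (\<lambda>x. a x (y x)) \<mu> y w"
    and stuck: "sgn \<mu>0 * \<mu> = 0 \<or> y 0 = C \<and> sgn \<mu>0 * \<mu> > 0 \<or> y 0 = - C \<and> sgn \<mu>0 * \<mu> < 0"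
    by (rule log_eigen_exists[OF \<open>p > 1\<close> \<open>T > 0\<close> _ conta a_bound, of C "sgn \<mu>0"])
      (auto simp: C_def)
  have osc: "\<bar>y x - y 0\<bar> \<le> L" if "x \<in> {0..T}" for x
    unfolding L_def by (rule log_eigen_bounds[OF \<open>p > 1\<close> \<open>T > 0\<close> eig a_bound that])
  have near: "\<bar>\<mu> - \<nu>\<bar> \<le> min \<bar>\<mu>0\<bar> \<bar>\<mu>inf\<bar> / 2"
    if eig': "log_eigen p T (\<lambda>x. q x - lam * k * m x) \<nu> y' w'"
      and close: "\<And>x. x \<in> {0..T} \<Longrightarrow> \<bar>g (y x) - k\<bar> < \<epsilon>" for k \<nu> y' w'
  proof (rule log_eigen_compare[OF \<open>p > 1\<close> \<open>T > 0\<close> eig eig'])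
    fix x assume x: "x \<in> {0..T}"
    have "\<bar>a x (y x) - (q x - lam * k * m x)\<bar> = \<bar>lam * m x * (k - g (y x))\<bar>"
      by (simp add: a_def algebra_simps)
    also have "\<dots> = lam * \<bar>m x\<bar> * \<bar>g (y x) - k\<bar>"
      using \<open>lam > 0\<close> by (simp add: abs_mult abs_minus_commute)
    also have "\<dots> \<le> lam * M * \<epsilon>"
      using M[OF x] close[OF x] \<open>lam > 0\<close> \<open>M > 0\<close> by (intro mult_mono) auto
    also have "\<dots> = min \<bar>\<mu>0\<bar> \<bar>\<mu>inf\<bar> / 2" using \<open>lam > 0\<close> \<open>M > 0\<close> by (simp add: \<epsilon>_def)
    finally show "\<bar>a x (y x) - (q x - lam * k * m x)\<bar> \<le> min \<bar>\<mu>0\<bar> \<bar>\<mu>inf\<bar> / 2" .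
  qed
  \<comment> \<open>Stuck at \<open>C\<close>, \<mu> would have the sign of \<open>\<mu>0\<close>
    and yet be close to \<open>\<mu>inf\<close>, of opposite sign; stuck at \<open>- C\<close>, it
    would have the sign opposite to \<open>\<mu>0\<close> and yet be close to
    \<open>\<mu>0\<close>.\<close>
  have "\<mu> = 0"
  proof (rule ccontr)
    assume "\<mu> \<noteq> 0"
    then consider "y 0 = C" "sgn \<mu>0 * \<mu> > 0" | "y 0 = - C" "sgn \<mu>0 * \<mu> < 0"
      using stuck opposite by (auto simp: sgn_if split: if_splits)
    then show False
    proof cases
      case 1
      have "\<bar>\<mu> - \<mu>inf\<bar> \<le> min \<bar>\<mu>0\<bar> \<bar>\<mu>inf\<bar> / 2"
      proof (rule near[OF eiginf])
        show "\<bar>g (y x) - finf\<bar> < \<epsilon>" if "x \<in> {0..T}" for x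
          using osc[OF that] 1(1) by (intro b2) (auto simp: C_def abs_le_iff)
      qed
      then show False using opposite 1(2) by (auto simp: sgn_if min_def abs_if split: if_splits)
    next
      case 2
      have "\<bar>\<mu> - \<mu>0\<bar> \<le> min \<bar>\<mu>0\<bar> \<bar>\<mu>inf\<bar> / 2"
      proof (rule near[OF eig0])
        show "\<bar>g (y x) - f0\<bar> < \<epsilon>" if "x \<in> {0..T}" for x
          using osc[OF that] 2(1) by (intro b1) (auto simp: C_def abs_le_iff)
      qed
      then show False using opposite 2(2) by (auto simp: sgn_if min_def abs_if split: if_splits)
    qed
  qed
  then have "classical_solution p T q m f lam (\<lambda>x. exp (y x))"
    using eig unfolding a_def g_def by (intro log_eigen_classical_solution \<open>p > 1\<close>) simp
  then show ?thesis by (intro exI[of _ "\<lambda>x. exp (y x)"]) simp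
qed

section \<open>Symmetries and conclusion\<close>

lemma classical_solution_reflect:
  assumes "classical_solution p T q m (\<lambda>s. - f (- s)) lam u"
  shows "classical_solution p T q m f lam (\<lambda>x. - u x)"
proof -
  obtain v where v: "\<And>x. x \<in> {0..T} \<Longrightarrow> (u has_real_derivative v x) (at x within {0..T})"
    "continuous_on {0..T} v"
    "\<And>x. x \<in> {0<..<T} \<Longrightarrow> \<exists>w. ((\<lambda>t. phi p (v t)) has_real_derivative w) (at x) \<and>
               - w + q x * phi p (u x) = lam * m x * - f (- u x)"
    "u 0 = u T" "v 0 = v T"
    using assms unfolding classical_solution_def by blast
  show ?thesis
    unfolding classical_solution_def
  proof (intro exI[of _ "\<lambda>x. - v x"] conjI ballI)
    fix x assume "x \<in> {0<..<T}"
    then obtain w where w: "((\<lambda>t. phi p (v t)) has_real_derivative w) (at x)"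
      "- w + q x * phi p (u x) = lam * m x * - f (- u x)" using v(3) by blast
    show "\<exists>w. ((\<lambda>t. phi p (- v t)) has_real_derivative w) (at x) \<and>
        - w + q x * phi p (- u x) = lam * m x * f (- u x)"
      using DERIV_minus[OF w(1)] w(2) by (intro exI[of _ "- w"]) (simp add: algebra_simps)
  qed (use v in \<open>auto intro!: DERIV_minus continuous_intros\<close>)
qed

lemma classical_solution_neg_weight:
  "classical_solution p T q (\<lambda>x. - m x) f (- lam) u = classical_solution p T q m f lam u"
  by (simp add: classical_solution_def)

lemma positive_and_negative_solution_exist:
  fixes q m f :: "real \<Rightarrow> real"
  assumes "T > 0" "p > 1" "continuous_on {0..T} q"
    and "\<And>x. x \<in> {0..T} \<Longrightarrow> q x \<ge> 0" "\<exists>x\<in>{0..T}. q x \<noteq> 0"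
    and "continuous_on {0..T} m" and contf: "continuous_on UNIV f"
    and f0: "((\<lambda>s. f s / phi p s) \<longlongrightarrow> f0) (at 0)" "f0 > 0"
    and finf: "((\<lambda>s. f s / phi p s) \<longlongrightarrow> finf) at_infinity" "finf > 0"
    and "s0 > 0" "log_eigen p T (\<lambda>x. q x - s0 * m x) 0 y0 w0"
      "(LINT x:{0<..<T}|lborel. m x * \<bar>exp (y0 x)\<bar> powr p) = 1"
    and "lam \<in> {s0 / finf<..<s0 / f0} \<union> {s0 / f0<..<s0 / finf}"
  shows "\<exists>u_pos u_neg.
           classical_solution p T q m f lam u_pos \<and> (\<forall>x\<in>{0..T}. u_pos x > 0) \<and>
           classical_solution p T q m f lam u_neg \<and> (\<forall>x\<in>{0..T}. u_neg x < 0)"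
proof -
  let ?f = "\<lambda>s. - f (- s)"
  \<comment> \<open>As \<open>phi p\<close> is odd, reflecting f only reflects the quotient, which
    changes neither its limit at 0 nor that at infinity.\<close>
  have ratio: "?f s / phi p s = (\<lambda>s. f s / phi p s) (- s)" for s by simp
  have "continuous_on UNIV ?f"
    by (intro continuous_on_minus continuous_on_compose2[OF contf] continuous_on_id) auto
  moreover have "((\<lambda>s. ?f s / phi p s) \<longlongrightarrow> f0) (at 0)"
    unfolding ratio
  proof (rule filterlim_compose[OF f0(1)])
    show "filterlim uminus (at (0::real)) (at 0)"
      unfolding filterlim_at by (auto simp: eventually_at_filter intro!: tendsto_eq_intros)
  qed
  moreover have "((\<lambda>s. ?f s / phi p s) \<longlongrightarrow> finf) at_infinity"
    unfolding ratio
  proof (rule filterlim_compose[OF finf(1)])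
    show "filterlim uminus at_infinity (at_infinity :: real filter)"
      by (rule filterlim_norm_at_top_imp_at_infinity) (simp only: norm_minus_cancel filterlim_norm_at_top)
  qed
  ultimately obtain u where u: "classical_solution p T q m ?f lam u" "\<forall>x\<in>{0..T}. u x > 0"
    using positive_solution_exists[OF assms(1-6) _ _ f0(2) _ finf(2) assms(12-15)] by blast
  obtain v where "classical_solution p T q m f lam v" "\<forall>x\<in>{0..T}. v x > 0"
    using positive_solution_exists[OF assms] by blast
  then show ?thesis
    using u(2) classical_solution_reflect[OF u(1)]
    by (intro exI[of _ v] exI[of _ "\<lambda>x. - u x"]) auto
qed

theorem theorem5p1:
  fixes T p f0 finf lam0 lam :: real and q m f :: "real \<Rightarrow> real"
  assumes "T > 0" and "p > 1"
    and "continuous_on {0..T} q" and "\<And>x. x \<in> {0..T} \<Longrightarrow> q x \<ge> 0"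
    and "\<exists>x\<in>{0..T}. q x \<noteq> 0"
    and "continuous_on {0..T} m"
    and "\<exists>x\<in>{0..T}. m x > 0" and "\<exists>x\<in>{0..T}. m x < 0"
    and "continuous_on UNIV f" and "\<And>s. s \<noteq> 0 \<Longrightarrow> f s * s > 0"
    and "((\<lambda>s. f s / phi p s) \<longlongrightarrow> f0) (at 0)" and "f0 > 0"
    and "((\<lambda>s. f s / phi p s) \<longlongrightarrow> finf) at_infinity" and "finf > 0"
    and "lam0 \<in> {lambda0_plus p T q m, lambda0_minus p T q m}"
    and "lam \<in> {lam0 / finf<..<lam0 / f0} \<union> {lam0 / f0<..<lam0 / finf}"
  shows "\<exists>u_pos u_neg.
           classical_solution p T q m f lam u_pos \<and> (\<forall>x\<in>{0..T}. u_pos x > 0) \<and>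
           classical_solution p T q m f lam u_neg \<and> (\<forall>x\<in>{0..T}. u_neg x < 0)"
proof -
  note solutions = positive_and_negative_solution_exist[OF assms(1-5) _ assms(9,11-14)]
  consider "lam0 = lambda0_plus p T q m" | "lam0 = lambda0_minus p T q m" using assms(15) by blast
  then show ?thesis
  proof cases
    case 1
    obtain s y w where s: "s > 0" "log_eigen p T (\<lambda>x. q x - s * m x) 0 y w"
      "(LINT x:{0<..<T}|lborel. m x * \<bar>exp (y x)\<bar> powr p) = 1"
      by (rule exists_critical_log_eigen[OF assms(2,1,3-7)]) (assumption, rule that)
    have "lam0 = s" unfolding 1 by (rule lambda0_plus_eq[OF assms(2,1,3,6) s(2,3)])
    then show ?thesis using solutions[OF _ assms(6) s] assms(16) by simp
  next
    case 2
    have m: "continuous_on {0..T} (\<lambda>x. - m x)" "\<exists>x\<in>{0..T}. - m x > 0"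
      using assms(6,8) by (auto intro: continuous_on_minus)
    obtain s y w where s: "s > 0" "log_eigen p T (\<lambda>x. q x - s * - m x) 0 y w"
      "(LINT x:{0<..<T}|lborel. - m x * \<bar>exp (y x)\<bar> powr p) = 1"
      by (rule exists_critical_log_eigen[OF assms(2,1,3-5) m]) (assumption, rule that)
    have "lam0 = - s" unfolding 2 by (rule lambda0_minus_eq[OF assms(2,1,3,6) s(2,3)])
    \<comment> \<open>Negation mirrors the intervals and swaps the end points of each, so the
      parameter \<open>- lam\<close> is admissible for the weight -m.\<close>
    then have "- lam \<in> {s / finf<..<s / f0} \<union> {s / f0<..<s / finf}"
      using assms(16) by auto
    from solutions[OF _ m(1) s this] show ?thesis
      by (simp add: classical_solution_neg_weight)
  qed
qed

end
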